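(* Let $m\ge 1$, $1<\theta<2$, and let $f:\mathbb{R}^m\to\mathbb{R}$ satisfy assumptions (H0) and (H1) recalled in the context. Suppose that $(\lambda_1,\phi)$ and $(\lambda_2,\psi)$ are two solutions of $(EP)$ with $\phi$ and $\psi$ bounded from below. Then $\lambda_1=\lambda_2$ and there exists a constant $C\in\mathbb{R}$ such that $\phi=\psi+C$ in $\mathbb{R}^m$.
   Context: A pair $(\lambda,\phi)\in\mathbb{R}\times C^2(\mathbb{R}^m)$ is a solution of $(EP)$ if $-\frac12\Delta\phi(y)+\frac1\theta|D\phi(y)|^\theta=f(y)-\lambda$ for all $y\in\mathbb{R}^m$. Assumptions on $f$, with common constants $\alpha>0$ and $f_0>0$: (H0) $f\in W^{1,\infty}_{\mathrm{loc}}(\mathbb{R}^m)$ (i.e. $f$ is locally Lipschitz continuous) is bounded from below and, for (almost) all $y\in\mathbb{R}^m$, $|Df(y)|\le f_0(1+|y|^{\alpha-1})$ if $\alpha\ge1$, or $|Df(y)|\le f_0$ if $\alpha<1$. (H1) $f_0^{-1}(|y|^\alpha+1)\le f(y)\le f_0(|y|^\alpha+1)$ for all $y\in\mathbb{R}^m$. *)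

theory Defs
  imports "HOL-Analysis.Analysis"
begin

(* The value is meaningful only at points where g is differentiable. *)
definition partial_deriv :: "'m::finite \<Rightarrow> (real^'m \<Rightarrow> real) \<Rightarrow> real^'m \<Rightarrow> real" where
  "partial_deriv i g y = frechet_derivative g (at y) (axis i 1)"

definition grad :: "(real^'m::finite \<Rightarrow> real) \<Rightarrow> real^'m \<Rightarrow> real^'m" where
  "grad g y = (\<chi> i. partial_deriv i g y)"

definition laplacian :: "(real^'m::finite \<Rightarrow> real) \<Rightarrow> real^'m \<Rightarrow> real" where
  "laplacian g y = (\<Sum>i\<in>UNIV. partial_deriv i (partial_deriv i g) y)"

primrec C_class :: "nat \<Rightarrow> (real^'m::finite \<Rightarrow> real) \<Rightarrow> bool" where
  "C_class 0 g \<longleftrightarrow> continuous_on UNIV g"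
| "C_class (Suc k) g \<longleftrightarrow>
     (\<forall>y. g differentiable at y) \<and> (\<forall>i. C_class k (partial_deriv i g))"

definition locally_lipschitz :: "(real^'m::finite \<Rightarrow> real) \<Rightarrow> bool" where
  "locally_lipschitz g \<longleftrightarrow> (\<forall>y. \<exists>u>0. \<exists>L. L-lipschitz_on (cball y u) g)"

(* A locally Lipschitz f is differentiable almost everywhere (Rademacher), so the
   differentiability conjuncts only say where the gradient is evaluated.
   For \<alpha> = 1 the convention 0 powr 0 = 0 affects the bound only at y = 0, a null set. *)
definition H0 :: "real \<Rightarrow> real \<Rightarrow> (real^'m::finite \<Rightarrow> real) \<Rightarrow> bool" where
  "H0 \<alpha> f0 f \<longleftrightarrow>
     locally_lipschitz f \<and> bdd_below (range f) \<and>
     (\<alpha> \<ge> 1 \<longrightarrow> (AE y in lebesgue. f differentiable at y \<and>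
                    norm (grad f y) \<le> f0 * (1 + norm y powr (\<alpha> - 1)))) \<and>
     (\<alpha> < 1 \<longrightarrow> (AE y in lebesgue. f differentiable at y \<and> norm (grad f y) \<le> f0))"

definition H1 :: "real \<Rightarrow> real \<Rightarrow> (real^'m::finite \<Rightarrow> real) \<Rightarrow> bool" where
  "H1 \<alpha> f0 f \<longleftrightarrow>
     (\<forall>y. inverse f0 * (norm y powr \<alpha> + 1) \<le> f y \<and> f y \<le> f0 * (norm y powr \<alpha> + 1))"

definition EP_solution ::
    "real \<Rightarrow> (real^'m::finite \<Rightarrow> real) \<Rightarrow> real \<times> (real^'m \<Rightarrow> real) \<Rightarrow> bool" where
  "EP_solution \<theta> f = (\<lambda>(\<mu>, u). C_class 2 u \<and>
     (\<forall>y. - (1/2) * laplacian u y + (1/\<theta>) * norm (grad u y) powr \<theta> = f y - \<mu>))"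

end

theory Submission
  imports Defs
begin

text \<open>
  Write \<open>H p = |p| powr \<theta> / \<theta>\<close>, let \<open>\<phi>\<close> and \<open>\<psi>\<close> be the two solutions, numbered so that
  \<open>lam1 \<ge> lam2\<close>, and put \<open>w = \<phi> - \<psi>\<close>. Convexity of \<open>H\<close> turns the difference of the two
  nonlinear equations into the linear inequality \<open>L w \<ge> lam1 - lam2 \<ge> 0\<close> for the operator
  \<open>L v = \<Delta>v / 2 - b \<bullet> Dv\<close> with the continuous drift \<open>b = |D\<psi>| powr (\<theta> - 2) D\<psi>\<close>, the gradient
  of \<open>H\<close> at \<open>D\<psi>\<close>. If \<open>w\<close> has a global maximum, the strong maximum principle makes it constant,
  and then \<open>lam1 - lam2 \<le> L w = 0\<close>.

  That \<open>w\<close> attains its maximum is a Liouville argument: it is enough to find a function \<open>V \<ge> 0\<close>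
  with \<open>L V < 0\<close> outside a ball that dominates \<open>w\<close> at infinity. For every \<open>\<epsilon> > 0\<close> the maximum of
  \<open>w - \<epsilon> V\<close> then lies in a ball that does not depend on \<open>\<epsilon>\<close>. The function
  \<open>V = (\<psi> + const)\<^sup>2\<close> does this. The equation for \<open>\<psi>\<close> gives
  \<open>L V \<le> |D\<psi>|\<^sup>2 - 2 (\<psi> + const) (f - lam2)\<close>, so what is needed are the growth rates
  \<open>|D\<psi>| = O(|y| powr (\<alpha>/\<theta>))\<close> and \<open>\<psi> \<ge> c |y| powr (1 + \<alpha>/\<theta>)\<close>; integrating the gradient rate
  also gives \<open>\<phi> = O(|y| powr (1 + \<alpha>/\<theta>))\<close>, which is \<open>o(V)\<close>.

  The lower bound (\<open>bounded_below_solution_growth\<close>) comes from comparing the solution with a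
  paraboloid on the ball of radius \<open>|y|/2\<close> around \<open>y\<close>, where \<open>f\<close> is at least of order
  \<open>|y| powr \<alpha>\<close>. The gradient rate (\<open>gradient_bound\<close>) is Bernstein's estimate: at the maximum of
  a cut-off multiple of \<open>|Du|\<^sup>2\<close> the Hessian term is at least \<open>(\<Delta>u)\<^sup>2 / m\<close>, hence of order
  \<open>|Du| powr (2 \<theta>)\<close>, and dominates every other term. Since \<open>u\<close> is only twice
  differentiable and \<open>f\<close> only Lipschitz, the equation cannot be differentiated; the estimate is
  run on difference quotients of \<open>u\<close>, which are twice differentiable, and only the final
  inequality is passed to the limit. The Lipschitz constants of \<open>f\<close> on balls are extracted from
  the almost everywhere gradient bound in \<open>lipschitz_from_ae_gradient_bound\<close>.
\<close>

section \<open>Partial derivatives and the second-order test\<close>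

text \<open>
  The derivative along a coordinate line, as a relation between a function and a value. Unlike
  \<open>partial_deriv\<close> it can be differentiated by rule without proving total differentiability first;
  this suits auxiliary functions, of which only the pure second derivatives are needed.
\<close>

definition has_partial :: "'m::finite \<Rightarrow> (real^'m \<Rightarrow> real) \<Rightarrow> real \<Rightarrow> real^'m \<Rightarrow> bool" where
  "has_partial i g d x \<longleftrightarrow> ((\<lambda>s. g (x + s *\<^sub>R axis i 1)) has_real_derivative d) (at 0)"

lemma has_partial_along_line:
  assumes "has_partial i g d (x + s *\<^sub>R axis i 1)"
  shows "((\<lambda>s. g (x + s *\<^sub>R axis i 1)) has_real_derivative d) (at s)"
proof -
  have "((\<lambda>t. g (x + (t + s) *\<^sub>R axis i 1)) has_real_derivative d) (at 0)"
    using assms unfolding has_partial_def by (simp add: algebra_simps)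
  then show ?thesis
    using DERIV_shift[of "\<lambda>s. g (x + s *\<^sub>R axis i 1)" d 0 s] by (simp add: add.commute)
qed

lemma has_partial_const: "has_partial i (\<lambda>x. c) 0 x"
  by (simp add: has_partial_def)

lemma has_partial_component: "has_partial i (\<lambda>x. (x - c) $ j) (if i = j then 1 else 0) x"
  unfolding has_partial_def by (auto intro!: derivative_eq_intros simp: axis_def)

lemma has_partial_add:
  "has_partial i f a x \<Longrightarrow> has_partial i g b x \<Longrightarrow> has_partial i (\<lambda>x. f x + g x) (a + b) x"
  unfolding has_partial_def by (rule DERIV_add)

lemma has_partial_diff:
  "has_partial i f a x \<Longrightarrow> has_partial i g b x \<Longrightarrow> has_partial i (\<lambda>x. f x - g x) (a - b) x"
  unfolding has_partial_def by (rule DERIV_diff)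

lemma has_partial_cmult:
  "has_partial i f a x \<Longrightarrow> has_partial i (\<lambda>x. c * f x) (c * a) x"
  unfolding has_partial_def by (rule DERIV_cmult)

lemma has_partial_mult:
  "has_partial i f a x \<Longrightarrow> has_partial i g b x \<Longrightarrow>
     has_partial i (\<lambda>x. f x * g x) (f x * b + a * g x) x"
  unfolding has_partial_def by (auto intro!: derivative_eq_intros)

lemma has_partial_power:
  "has_partial i f a x \<Longrightarrow> has_partial i (\<lambda>x. f x ^ n) (real n * f x ^ (n - 1) * a) x"
  unfolding has_partial_def by (auto intro!: derivative_eq_intros)

lemma has_partial_sum:
  "(\<And>k. k \<in> A \<Longrightarrow> has_partial i (f k) (d k) x) \<Longrightarrow>
     has_partial i (\<lambda>x. \<Sum>k\<in>A. f k x) (\<Sum>k\<in>A. d k) x"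
  unfolding has_partial_def by (rule DERIV_sum)

lemma has_partial_translate:
  "has_partial i g d (x + v) \<Longrightarrow> has_partial i (\<lambda>x. g (x + v)) d x"
  unfolding has_partial_def by (simp add: algebra_simps)

lemma norm_sq_sum: "(norm (x::real^'m))\<^sup>2 = (\<Sum>j\<in>UNIV. (x $ j)\<^sup>2)"
  by (simp add: norm_vec_def L2_set_def sum_nonneg)

lemma has_partial_norm_sq: "has_partial i (\<lambda>x. (norm (x - c))\<^sup>2) (2 * (x - c) $ i) x"
proof -
  have "has_partial i (\<lambda>x. \<Sum>j\<in>UNIV. ((x - c) $ j)^2)
     (\<Sum>j\<in>UNIV. real 2 * (x - c) $ j ^ (2-1) * (if i = j then 1 else 0)) x"
    by (intro has_partial_sum has_partial_power has_partial_component)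
  moreover have "(\<Sum>j\<in>UNIV. real 2 * (x - c) $ j ^ (2-1) * (if i = j then 1 else 0)) = 2 * (x - c) $ i"
    by (simp add: if_distrib cong: if_cong)
  ultimately show ?thesis by (simp only: norm_sq_sum)
qed

text \<open>
  If the second derivative were positive, the first derivative would be positive just to the right of
  the critical point, and the function would increase there.
\<close>

lemma local_max_partials:
  assumes r: "r > 0"
    and g1: "\<And>y. y \<in> ball x r \<Longrightarrow> has_partial i g (g1 y) y"
    and g2: "has_partial i g1 d x"
    and mx: "\<And>y. y \<in> ball x r \<Longrightarrow> g y \<le> g x"
  shows "g1 x = 0" and "d \<le> 0"
proof -
  define h where "h = (\<lambda>s. g (x + s *\<^sub>R axis i 1))"
  have inb: "x + s *\<^sub>R axis i 1 \<in> ball x r" if "\<bar>s\<bar> < r" for s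
    using that by (simp add: dist_norm)
  have dh: "(h has_real_derivative g1 (x + s *\<^sub>R axis i 1)) (at s)" if "\<bar>s\<bar> < r" for s
    unfolding h_def by (rule has_partial_along_line[OF g1[OF inb[OF that]]])
  have h0: "(h has_real_derivative g1 x) (at 0)" using dh[of 0] r by simp
  have hmax: "h s \<le> h 0" if "\<bar>s\<bar> < r" for s
    using mx[OF inb[OF that]] by (simp add: h_def)
  show z: "g1 x = 0"
    by (rule DERIV_local_max[OF h0 r]) (simp add: hmax)
  show "d \<le> 0"
  proof (rule ccontr)
    assume "\<not> d \<le> 0"
    then have "d > 0" by simp
    from DERIV_pos_inc_right[OF g2[unfolded has_partial_def] this] z
    obtain e where e: "e > 0" "\<And>s. 0 < s \<Longrightarrow> s < e \<Longrightarrow> g1 (x + s *\<^sub>R axis i 1) > 0"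
      by auto
    define t where "t = min e r / 2"
    have t: "0 < t" "t < e" "t < r" using e r by (auto simp: t_def)
    obtain s where s: "0 < s" "s < t" "h t - h 0 = (t - 0) * g1 (x + s *\<^sub>R axis i 1)"
      using MVT2[OF t(1), of h "\<lambda>s. g1 (x + s *\<^sub>R axis i 1)"] dh t by force
    have "h t > h 0" using s e(2)[of s] t by (simp add: algebra_simps)
    with hmax[of t] t show False by simp
  qed
qed

lemma local_max_grad_laplacian:
  fixes g :: "real^'m::finite \<Rightarrow> real"
  assumes r: "r > 0"
    and g1: "\<And>i y. y \<in> ball x r \<Longrightarrow> has_partial i g (g1 i y) y"
    and g2: "\<And>i. has_partial i (g1 i) (d i) x"
    and mx: "\<And>y. y \<in> ball x r \<Longrightarrow> g y \<le> g x"
  shows "g1 i x = 0" and "(\<Sum>i\<in>UNIV. d i) \<le> 0"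
  using local_max_partials[OF r g1 g2 mx] by (auto intro: sum_nonpos)

lemma has_partial_differentiable:
  assumes "g differentiable at x"
  shows "has_partial i g (partial_deriv i g x) x"
proof -
  have d: "(g has_derivative frechet_derivative g (at x)) (at x)"
    using assms frechet_derivative_works by blast
  have "((\<lambda>s. g (x + s *\<^sub>R axis i 1)) has_derivative
          (\<lambda>s. frechet_derivative g (at x) (s *\<^sub>R axis i 1))) (at 0)"
    by (rule has_derivative_compose[where f="\<lambda>s. x + s *\<^sub>R axis i 1"])
       (auto intro!: derivative_eq_intros d)
  moreover have "frechet_derivative g (at x) (s *\<^sub>R axis i 1) = partial_deriv i g x * s" for s
    using linear_scale[OF linear_frechet_derivative[OF assms], of s "axis i 1"]
    by (simp add: partial_deriv_def)
  ultimately show ?thesis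
    by (simp add: has_partial_def has_field_derivative_def)
qed

lemma frechet_derivative_eq_grad:
  fixes g :: "real^'m::finite \<Rightarrow> real"
  assumes "g differentiable at x"
  shows "frechet_derivative g (at x) h = grad g x \<bullet> h"
proof -
  have lin: "linear (frechet_derivative g (at x))" by (rule linear_frechet_derivative[OF assms])
  have "frechet_derivative g (at x) h = frechet_derivative g (at x) (\<Sum>i\<in>UNIV. h $ i *s axis i 1)"
    by (simp add: basis_expansion)
  also have "\<dots> = (\<Sum>i\<in>UNIV. h $ i * partial_deriv i g x)"
    by (simp add: linear_sum[OF lin] linear_scale[OF lin] partial_deriv_def scalar_mult_eq_scaleR)
  also have "\<dots> = grad g x \<bullet> h"
    by (simp add: inner_vec_def grad_def mult.commute)
  finally show ?thesis .
qed

lemma has_derivative_grad: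
  fixes g :: "real^'m::finite \<Rightarrow> real"
  assumes "g differentiable at x"
  shows "(g has_derivative (\<lambda>h. grad g x \<bullet> h)) (at x)"
proof -
  have "frechet_derivative g (at x) = (\<lambda>h. grad g x \<bullet> h)"
    using frechet_derivative_eq_grad[OF assms] by blast
  then show ?thesis using assms frechet_derivative_works by metis
qed

lemma C2D:
  assumes "C_class 2 u"
  shows "u differentiable at x" and "partial_deriv i u differentiable at x"
    and "continuous_on UNIV (partial_deriv j (partial_deriv i u))"
  using assms by (auto simp: numeral_2_eq_2)

lemma C2_has_partial:
  assumes "C_class 2 u"
  shows "has_partial i u (grad u x $ i) x"
    and "has_partial j (partial_deriv i u) (partial_deriv j (partial_deriv i u) x) x"
    and "has_partial j (\<lambda>x. grad u x $ i) (partial_deriv j (partial_deriv i u) x) x"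
  using C2D[OF assms] by (auto simp: grad_def intro!: has_partial_differentiable)

lemma C2_continuous:
  assumes "C_class 2 u"
  shows "continuous_on UNIV u" "continuous_on UNIV (partial_deriv i u)" "continuous_on UNIV (grad u)"
proof -
  show "continuous_on UNIV u"
    using C2D(1)[OF assms] by (simp add: continuous_at_imp_continuous_on differentiable_imp_continuous_within)
  show p: "continuous_on UNIV (partial_deriv i u)" for i
    using C2D(2)[OF assms] by (simp add: continuous_at_imp_continuous_on differentiable_imp_continuous_within)
  show "continuous_on UNIV (grad u)"
    unfolding grad_def by (intro continuous_on_vec_lambda p)
qed

lemma C2_grad_along_line:
  assumes "C_class 2 u"
  shows "((\<lambda>s. grad u (x + s *\<^sub>R axis e 1)) has_vector_derivative
            (\<chi> i. partial_deriv e (partial_deriv i u) x)) (at 0)"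
proof -
  have "((\<lambda>s. grad u (x + s *\<^sub>R axis e 1) $ i) has_derivative
          (\<lambda>s. (s *\<^sub>R (\<chi> i. partial_deriv e (partial_deriv i u) x)) $ i)) (at 0)" for i
    using C2_has_partial(3)[OF assms, of e i x]
    by (simp add: has_partial_def has_field_derivative_def mult.commute[of _ "partial_deriv _ _ _"])
  then show ?thesis
    unfolding has_vector_derivative_def
    by (subst has_derivative_componentwise_within) (auto simp: Basis_vec_def inner_axis)
qed

section \<open>The power Hamiltonian\<close>

text \<open>
  At the origin the derivative is zero because \<open>|h| powr \<theta>\<close> is \<open>o(|h|)\<close> for \<open>\<theta> > 1\<close>; there
  \<open>0 powr (\<theta> - 2)\<close> takes the value 0, so the formula holds at all points.
\<close>

lemma norm_powr_has_derivative:
  fixes p :: "real^'m::finite"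
  assumes "1 < \<theta>"
  shows "((\<lambda>p. (1/\<theta>) * norm p powr \<theta>) has_derivative
           (\<lambda>h. (norm p powr (\<theta> - 2) *\<^sub>R p) \<bullet> h)) (at p)"
proof (cases "p = 0")
  case False
  have "(norm has_derivative (\<lambda>h. h \<bullet> sgn p)) (at p)"
    using has_derivative_norm[OF False] by simp
  then have "((\<lambda>p. (1/\<theta>) * norm p powr \<theta>) has_derivative
           (\<lambda>h. (1/\<theta>) * (norm p powr \<theta> * (\<theta> * (h \<bullet> sgn p) / norm p)))) (at p)"
    using False assms by (auto intro!: derivative_eq_intros)
  moreover have "(1/\<theta>) * (norm p powr \<theta> * (\<theta> * (h \<bullet> sgn p) / norm p))
       = (norm p powr (\<theta> - 2) *\<^sub>R p) \<bullet> h" for h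
    using False assms
    by (simp add: sgn_div_norm powr_diff inner_commute power2_eq_square field_simps)
  ultimately show ?thesis by simp
next
  case True
  have "((\<lambda>h. norm h powr (\<theta> - 1)) \<longlongrightarrow> 0) (at (0::real^'m))"
  proof -
    have "((\<lambda>h::real^'m. norm h) \<longlongrightarrow> 0) (at 0)" by (rule tendsto_norm_zero) (rule tendsto_ident_at)
    from tendsto_powr'[OF this tendsto_const[of "\<theta> - 1"]] show ?thesis using assms by simp
  qed
  then have "((\<lambda>h. (1/\<theta>) * norm h powr (\<theta> - 1)) \<longlongrightarrow> 0) (at (0::real^'m))"
    using tendsto_mult_right_zero by blast
  moreover have "(1/\<theta>) * norm h powr (\<theta> - 1) = norm ((1/\<theta>) * norm h powr \<theta>) / norm h" for h :: "real^'m"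
    using assms by (cases "h = 0") (auto simp: powr_diff)
  ultimately show ?thesis using True assms
    by (simp add: has_derivative_at_within divide_inverse mult_ac)
qed

lemma norm_powr_gradient_norm:
  fixes p :: "real^'m::finite"
  assumes "1 < \<theta>"
  shows "norm (norm p powr (\<theta> - 2) *\<^sub>R p) = norm p powr (\<theta> - 1)"
proof (cases "p = 0")
  case False
  have "norm p powr (\<theta> - 2) * norm p powr 1 = norm p powr (\<theta> - 1)"
    by (subst powr_add[symmetric]) simp
  then show ?thesis using False by simp
qed simp

lemma norm_powr_gradient_continuous:
  assumes "1 < \<theta>"
  shows "continuous_on UNIV (\<lambda>p::real^'m::finite. norm p powr (\<theta> - 2) *\<^sub>R p)"
proof -
  have "isCont (\<lambda>p::real^'m. norm p powr (\<theta> - 2) *\<^sub>R p) p" for p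
  proof (cases "p = 0")
    case True
    have "((\<lambda>h::real^'m. norm h) \<longlongrightarrow> 0) (at 0)" by (rule tendsto_norm_zero) (rule tendsto_ident_at)
    from tendsto_powr'[OF this tendsto_const[of "\<theta> - 1"]] assms
    have "((\<lambda>h::real^'m. norm (norm h powr (\<theta> - 2) *\<^sub>R h)) \<longlongrightarrow> 0) (at 0)"
      unfolding norm_powr_gradient_norm[OF assms] by simp
    then show ?thesis using True by (simp add: isCont_def tendsto_norm_zero_iff del: norm_scaleR)
  qed (auto intro!: continuous_intros)
  then show ?thesis by (simp add: continuous_at_imp_continuous_on)
qed

text \<open>
  The tangent-plane inequality for \<open>H\<close>, which is Young's inequality for the conjugate exponents
  \<open>\<theta>\<close> and \<open>\<theta> / (\<theta> - 1)\<close>.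
\<close>

lemma norm_powr_convex:
  fixes p q :: "real^'m::finite"
  assumes "1 < \<theta>"
  shows "(1/\<theta>) * norm p powr \<theta> - (1/\<theta>) * norm q powr \<theta>
           \<ge> (norm q powr (\<theta> - 2) *\<^sub>R q) \<bullet> (p - q)"
proof -
  define \<eta> where "\<eta> = \<theta> / (\<theta> - 1)"
  have y: "norm p * norm q powr (\<theta> - 1) \<le> norm p powr \<theta> / \<theta> + (norm q powr (\<theta> - 1)) powr \<eta> / \<eta>"
    using assms by (intro Youngs_inequality) (auto simp: \<eta>_def field_simps)
  have e: "(norm q powr (\<theta> - 1)) powr \<eta> = norm q powr \<theta>"
    using assms by (simp add: \<eta>_def powr_powr)
  have e2: "X / \<eta> = X - X / \<theta>" for X
    using assms by (simp add: \<eta>_def field_simps)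
  have qq: "(norm q powr (\<theta> - 2) *\<^sub>R q) \<bullet> q = norm q powr \<theta>"
  proof (cases "q = 0")
    case False
    have "norm q powr (\<theta> - 2) * norm q powr 2 = norm q powr \<theta>"
      by (subst powr_add[symmetric]) simp
    then show ?thesis using False by (simp add: power2_norm_eq_inner[symmetric])
  qed simp
  have "(norm q powr (\<theta> - 2) *\<^sub>R q) \<bullet> p \<le> norm q powr (\<theta> - 1) * norm p"
    using norm_cauchy_schwarz[of "norm q powr (\<theta> - 2) *\<^sub>R q" p]
    by (simp only: norm_powr_gradient_norm[OF assms])
  then show ?thesis using y unfolding e e2 inner_diff_right qq by (simp add: mult.commute)
qed

lemma C2_has_partial_norm_powr:
  fixes u :: "real^'m::finite \<Rightarrow> real"
  assumes "C_class 2 u" "1 < \<theta>"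
  shows "has_partial e (\<lambda>x. (1/\<theta>) * norm (grad u x) powr \<theta>)
     ((norm (grad u x) powr (\<theta> - 2) *\<^sub>R grad u x) \<bullet> (\<chi> i. partial_deriv e (partial_deriv i u) x)) x"
proof -
  have "((\<lambda>s. (1/\<theta>) * norm (grad u (x + s *\<^sub>R axis e 1)) powr \<theta>) has_derivative
     (\<lambda>s. (norm (grad u x) powr (\<theta> - 2) *\<^sub>R grad u x) \<bullet> (s *\<^sub>R (\<chi> i. partial_deriv e (partial_deriv i u) x)))) (at 0)"
    by (rule has_derivative_compose[OF C2_grad_along_line[OF assms(1), unfolded has_vector_derivative_def]])
       (use norm_powr_has_derivative[OF assms(2), of "grad u x"] in simp)
  moreover have "(\<lambda>s. (norm (grad u x) powr (\<theta> - 2) *\<^sub>R grad u x) \<bullet> (s *\<^sub>R (\<chi> i. partial_deriv e (partial_deriv i u) x)))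
     = (*) ((norm (grad u x) powr (\<theta> - 2) *\<^sub>R grad u x) \<bullet> (\<chi> i. partial_deriv e (partial_deriv i u) x))"
    by (auto simp: mult.commute)
  ultimately show ?thesis
    by (simp only: has_partial_def has_field_derivative_def)
qed

lemma gradient_drift_continuous:
  assumes "C_class 2 u" "1 < \<theta>"
  shows "continuous_on UNIV (\<lambda>x. norm (grad u x) powr (\<theta> - 2) *\<^sub>R grad u x)"
  using continuous_on_compose2[OF norm_powr_gradient_continuous[OF assms(2)] C2_continuous(3)[OF assms(1)]]
  by simp

section \<open>Lipschitz constants from almost everywhere gradient bounds\<close>

lemma AE_lebesgue_translate:
  fixes a :: "'a::euclidean_space"
  assumes "AE z in lebesgue. P z"
  shows "AE z in lebesgue. P (a + z)"
proof -
  from assms obtain N where N: "{z. \<not> P z} \<subseteq> N" "N \<in> null_sets lebesgue"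
    by (auto simp: eventually_ae_filter)
  then have "negligible ((+) (- a) ` N)"
    by (intro negligible_translation) (simp add: negligible_iff_null_sets)
  moreover have "{z. \<not> P (a + z)} \<subseteq> (+) (- a) ` N"
  proof
    fix z assume "z \<in> {z. \<not> P (a + z)}"
    then have "a + z \<in> N" using N by auto
    then show "z \<in> (+) (- a) ` N" by (intro image_eqI[of _ _ "a + z"]) auto
  qed
  ultimately show ?thesis
    by (auto simp: eventually_ae_filter negligible_iff_null_sets)
qed

lemma locally_lipschitz_on_cball:
  fixes f :: "real^'m::finite \<Rightarrow> real"
  assumes "locally_lipschitz f"
  obtains L where "L-lipschitz_on (cball c \<rho>) f"
proof -
  have "local_lipschitz {0::real} (cball c \<rho>) (\<lambda>t. f)"
  proof (rule local_lipschitzI)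
    fix t :: real and x assume "x \<in> cball c \<rho>"
    from assms obtain u L where "u > 0" "L-lipschitz_on (cball x u) f"
      unfolding locally_lipschitz_def by blast
    then show "\<exists>u>0. \<exists>L. \<forall>t\<in>cball t u \<inter> {0}. L-lipschitz_on (cball x u \<inter> cball c \<rho>) f"
      by (meson inf_le1 lipschitz_on_subset)
  qed
  from local_lipschitz_compact_implies_lipschitz[OF this] that show thesis
    by (metis compact_cball compact_insert compact_empty continuous_on_const singletonI)
qed

lemma locally_lipschitz_continuous:
  assumes "locally_lipschitz f"
  shows "continuous_on UNIV f"
proof -
  have "isCont f x" for x
  proof -
    obtain L where "L-lipschitz_on (cball x 1) f" by (rule locally_lipschitz_on_cball[OF assms])
    then have "continuous_on (cball x 1) f" by (rule lipschitz_on_continuous_on)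
    then show ?thesis by (rule continuous_on_interior) simp
  qed
  then show ?thesis by (simp add: continuous_at_imp_continuous_on)
qed

lemma differentiable_difference_quotient:
  fixes f :: "real^'m::finite \<Rightarrow> real"
  assumes "f differentiable at p" "X \<longlonglongrightarrow> 0" "\<And>n. X n \<noteq> 0"
  shows "(\<lambda>n. (f (p + X n *\<^sub>R h) - f p) / X n) \<longlonglongrightarrow> grad f p \<bullet> h"
proof -
  have "((\<lambda>s. f (p + s *\<^sub>R h)) has_derivative (\<lambda>s. grad f p \<bullet> (s *\<^sub>R h))) (at 0)"
    by (rule has_derivative_compose[where f="\<lambda>s. p + s *\<^sub>R h"])
       (use has_derivative_grad[OF assms(1)] in \<open>auto intro!: derivative_eq_intros\<close>)
  then have "((\<lambda>s. f (p + s *\<^sub>R h)) has_real_derivative grad f p \<bullet> h) (at 0)"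
    by (simp add: has_field_derivative_def mult.commute[of _ "grad f p \<bullet> h"])
  then have "((\<lambda>s. (f (p + s *\<^sub>R h) - f p) / s) \<longlongrightarrow> grad f p \<bullet> h) (at 0)"
    by (simp add: DERIV_def)
  then show ?thesis
    using assms(2,3) by (auto simp: tendsto_at_iff_sequentially comp_def)
qed

text \<open>
  A gradient bound that holds almost everywhere says nothing about a single segment, which is a
  null set. Averaging over translates of the segment repairs this: the average of \<open>f\<close> over a small
  ball moving from \<open>x\<close> to \<open>y\<close> is differentiable in time by dominated convergence, and its
  derivative is an average of directional derivatives of \<open>f\<close>.
\<close>

lemma averaged_difference_bound:
  fixes f :: "real^'m::finite \<Rightarrow> real" and x y :: "real^'m"
  assumes lip: "locally_lipschitz f"
    and ae: "AE p in lebesgue. p \<in> S \<longrightarrow> f differentiable at p \<and> norm (grad f p) \<le> K"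
    and S: "convex S" and r: "r > 0" and xy: "cball x r \<subseteq> S" "cball y r \<subseteq> S"
  defines "M \<equiv> lebesgue_on (cball 0 r :: (real^'m) set)"
  shows "\<bar>integral\<^sup>L M (\<lambda>z. f (y + z) - f (x + z))\<bar> \<le> K * norm (y - x) * measure lebesgue (cball 0 r :: (real^'m) set)"
proof -
  define h where "h = y - x"
  define F where "F = (\<lambda>t. integral\<^sup>L M (\<lambda>z. f (x + t *\<^sub>R h + z)))"
  have cf: "continuous_on UNIV f" by (rule locally_lipschitz_continuous[OF lip])
  have meas: "(\<lambda>z. f (a + z)) \<in> borel_measurable M" for a
  proof -
    have "continuous_on (cball 0 r) (\<lambda>z. f (a + z))"
      by (intro continuous_on_compose2[OF cf] continuous_intros) auto
    then show ?thesis unfolding M_def by (rule continuous_imp_measurable_on_sets_lebesgue) auto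
  qed
  have fin: "finite_measure M"
    unfolding M_def by (intro finite_measure_lebesgue_on) auto
  have int: "integrable M (\<lambda>z. f (a + z))" for a
  proof -
    have "compact ((\<lambda>z. f (a + z)) ` cball 0 r)"
      by (intro compact_continuous_image continuous_on_compose2[OF cf] continuous_intros) auto
    then obtain B where B: "\<And>z. z \<in> cball 0 r \<Longrightarrow> \<bar>f (a + z)\<bar> \<le> B"
      by (force simp: bounded_iff dest!: compact_imp_bounded)
    show ?thesis
      by (rule finite_measure.integrable_const_bound[OF fin, where B = B])
         (auto simp: M_def B intro!: AE_I2 meas[unfolded M_def])
  qed
  have seg: "x + t *\<^sub>R h + z \<in> S" if "0 \<le> t" "t \<le> 1" "z \<in> cball 0 r" for t z
  proof -
    have "x + z \<in> S" "y + z \<in> S" using xy that(3) by (auto simp: dist_norm subset_iff)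
    then have "(1 - t) *\<^sub>R (x + z) + t *\<^sub>R (y + z) \<in> S"
      using S that by (simp add: convex_alt)
    then show ?thesis by (simp add: h_def algebra_simps)
  qed
  have main: "\<exists>D. (F has_real_derivative D) (at t) \<and> \<bar>D\<bar> \<le> K * norm h * measure lebesgue (cball 0 r :: (real^'m) set)"
    if t: "0 \<le> t" "t \<le> 1" for t
  proof -
    define q where "q = (\<lambda>s z. (f (x + (t + s) *\<^sub>R h + z) - f (x + t *\<^sub>R h + z)) / s)"
    \<comment> \<open>The integrand of the derivative is taken as a limit of quotients, which makes it measurable.\<close>
    define g where "g = (\<lambda>z. lim (\<lambda>n. q (inverse (real (Suc n))) z))"
    have qm: "q s \<in> borel_measurable M" for s
      unfolding q_def by (intro borel_measurable_divide borel_measurable_diff meas borel_measurable_const)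
    have gm: "g \<in> borel_measurable M"
      unfolding g_def by (rule borel_measurable_lim_metric) (rule qm)
    have "AE z in lebesgue. x + t *\<^sub>R h + z \<in> S \<longrightarrow> f differentiable at (x + t *\<^sub>R h + z)
        \<and> norm (grad f (x + t *\<^sub>R h + z)) \<le> K"
      by (rule AE_lebesgue_translate[OF ae])
    then have aeM: "AE z in M. f differentiable at (x + t *\<^sub>R h + z)
        \<and> norm (grad f (x + t *\<^sub>R h + z)) \<le> K"
      unfolding M_def by (subst AE_restrict_space_iff) (auto intro: seg[OF t] elim!: eventually_mono)
    have qlim: "(\<lambda>n. q (X n) z) \<longlonglongrightarrow> grad f (x + t *\<^sub>R h + z) \<bullet> h"
      if "f differentiable at (x + t *\<^sub>R h + z)" "X \<longlonglongrightarrow> 0" "\<And>n. X n \<noteq> 0" for z X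
      using differentiable_difference_quotient[OF that, of h]
      by (simp add: q_def algebra_simps)
    have inv: "(\<lambda>n. inverse (real (Suc n))) \<longlonglongrightarrow> 0" by (rule LIMSEQ_inverse_real_of_nat)
    have geq: "g z = grad f (x + t *\<^sub>R h + z) \<bullet> h" if "f differentiable at (x + t *\<^sub>R h + z)" for z
      unfolding g_def by (rule limI) (rule qlim[OF that inv], simp)
    have gae: "AE z in M. \<bar>g z\<bar> \<le> K * norm h"
      using aeM
    proof eventually_elim
      case (elim z)
      then have "\<bar>g z\<bar> \<le> norm (grad f (x + t *\<^sub>R h + z)) * norm h"
        by (simp add: geq Cauchy_Schwarz_ineq2)
      also have "\<dots> \<le> K * norm h" using elim by (intro mult_right_mono) auto
      finally show ?case .
    qed
    have "(F has_real_derivative integral\<^sup>L M g) (at t)"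
      unfolding DERIV_def tendsto_at_iff_sequentially
    proof (intro allI impI)
      fix X :: "nat \<Rightarrow> real" assume X: "\<forall>n. X n \<in> UNIV - {0}" "X \<longlonglongrightarrow> 0"
      obtain B where B: "\<And>n. \<bar>X n\<bar> \<le> B"
        using convergent_imp_Bseq[of X] X(2) by (auto simp: convergent_def Bseq_def)
      obtain L where L: "L-lipschitz_on (cball x ((1 + B) * norm h + r)) f"
        by (rule locally_lipschitz_on_cball[OF lip])
      have inb: "x + s *\<^sub>R h + z \<in> cball x ((1 + B) * norm h + r)" if "\<bar>s\<bar> \<le> 1 + B" "norm z \<le> r" for s z
      proof -
        have "norm (s *\<^sub>R h + z) \<le> \<bar>s\<bar> * norm h + norm z"
          by (metis norm_scaleR norm_triangle_ineq)
        also have "\<dots> \<le> (1 + B) * norm h + r" using that by (intro add_mono mult_right_mono) auto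
        finally have "norm (s *\<^sub>R h + z) \<le> (1 + B) * norm h + r" .
        moreover have "dist x (x + s *\<^sub>R h + z) = norm (s *\<^sub>R h + z)"
          using norm_minus_cancel[of "s *\<^sub>R h + z"] by (simp add: dist_norm algebra_simps)
        ultimately show ?thesis by simp
      qed
      have B0: "0 \<le> B" using B[of 0] by simp
      have dom: "AE z in M. norm (q (X n) z) \<le> L * norm h" for n
      proof (rule AE_I2)
        fix z assume "z \<in> space M"
        then have z: "norm z \<le> r" by (simp add: M_def)
        have "\<bar>f (x + (t + X n) *\<^sub>R h + z) - f (x + t *\<^sub>R h + z)\<bar>
            \<le> L * dist (x + (t + X n) *\<^sub>R h + z) (x + t *\<^sub>R h + z)"
          using lipschitz_onD[OF L inb[OF _ z] inb[OF _ z], of "t + X n" t] B[of n] B0 t by (simp add: dist_real_def)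
        also have "\<dots> = L * norm h * \<bar>X n\<bar>" by (simp add: dist_norm algebra_simps)
        finally show "norm (q (X n) z) \<le> L * norm h"
          using X(1) by (simp add: q_def divide_simps)
      qed
      have "(\<lambda>n. integral\<^sup>L M (q (X n))) \<longlonglongrightarrow> integral\<^sup>L M g"
      proof (rule integral_dominated_convergence[OF gm qm])
        show "integrable M (\<lambda>z. L * norm h)"
          using finite_measure.integrable_const[OF fin] .
        show "AE z in M. (\<lambda>n. q (X n) z) \<longlonglongrightarrow> g z"
          using aeM by eventually_elim (use qlim X geq in auto)
      qed (rule dom)
      moreover have "integral\<^sup>L M (q s) = (F (t + s) - F t) / s" for s
        unfolding q_def F_def by (simp add: int)
      ultimately show "((\<lambda>s. (F (t + s) - F t) / s) \<circ> X) \<longlonglongrightarrow> integral\<^sup>L M g"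
        by (simp add: comp_def)
    qed
    moreover have "\<bar>integral\<^sup>L M g\<bar> \<le> K * norm h * measure lebesgue (cball 0 r :: (real^'m) set)"
    proof -
      have ig: "integrable M g"
        by (rule finite_measure.integrable_const_bound[OF fin _ gm, where B = "K * norm h"]) (use gae in simp)
      have "\<bar>integral\<^sup>L M g\<bar> \<le> integral\<^sup>L M (\<lambda>z. \<bar>g z\<bar>)"
        using integral_norm_bound[of M g] by simp
      also have "\<dots> \<le> integral\<^sup>L M (\<lambda>z. K * norm h)"
        by (intro integral_mono_AE gae) (use ig finite_measure.integrable_const[OF fin] in auto)
      also have "\<dots> = K * norm h * measure lebesgue (cball 0 r :: (real^'m) set)"
        by (simp add: M_def measure_restrict_space)
      finally show ?thesis .
    qed
    ultimately show ?thesis by blast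
  qed
  then obtain D where D: "\<And>t. 0 \<le> t \<Longrightarrow> t \<le> 1 \<Longrightarrow> (F has_real_derivative D t) (at t)"
    "\<And>t. 0 \<le> t \<Longrightarrow> t \<le> 1 \<Longrightarrow> \<bar>D t\<bar> \<le> K * norm h * measure lebesgue (cball 0 r :: (real^'m) set)"
    by metis
  obtain t where t: "0 < t" "t < 1" "F 1 - F 0 = (1 - 0) * D t"
    using MVT2[of 0 1 F D] D(1) by auto
  have "F 1 - F 0 = integral\<^sup>L M (\<lambda>z. f (y + z) - f (x + z))"
    by (simp add: F_def int h_def)
  then show ?thesis using t D(2)[of t] by (simp add: h_def)
qed

text \<open>
  The radius of the averaging ball is sent to zero in \<open>averaged_difference_bound\<close>. The local
  Lipschitz constant \<open>L\<close> controls the averaging error only and drops out of the bound.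
\<close>

lemma lipschitz_from_ae_gradient_bound:
  fixes f :: "real^'m::finite \<Rightarrow> real"
  assumes lip: "locally_lipschitz f"
    and ae: "AE p in lebesgue. p \<in> ball c \<rho> \<longrightarrow> f differentiable at p \<and> norm (grad f p) \<le> K"
    and xy: "x \<in> ball c \<rho>" "y \<in> ball c \<rho>"
  shows "\<bar>f y - f x\<bar> \<le> K * norm (y - x)"
proof (rule field_le_epsilon)
  fix e :: real assume e: "e > 0"
  obtain L where L: "L-lipschitz_on (cball c \<rho>) f" by (rule locally_lipschitz_on_cball[OF lip])
  have L0: "L \<ge> 0" by (rule lipschitz_on_nonneg[OF L])
  from xy obtain r1 r2 where r12: "r1 > 0" "r2 > 0" "cball x r1 \<subseteq> ball c \<rho>" "cball y r2 \<subseteq> ball c \<rho>"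
    by (meson open_ball open_contains_cball)
  define r where "r = min (min r1 r2) (e / (2 * L + 1))"
  have r: "r > 0" using r12 L0 e by (auto simp: r_def)
  have sub: "cball x r \<subseteq> ball c \<rho>" "cball y r \<subseteq> ball c \<rho>"
    using r12 by (auto simp: r_def subset_iff)
  have Lr: "2 * L * r \<le> e"
  proof -
    have "(2 * L + 1) * r \<le> (2 * L + 1) * (e / (2 * L + 1))"
      using L0 by (intro mult_left_mono) (auto simp: r_def)
    also have "\<dots> = e" using L0 by simp
    finally show ?thesis using r by (simp add: algebra_simps)
  qed
  define M where "M = lebesgue_on (cball 0 r :: (real^'m) set)"
  define v where "v = measure lebesgue (cball 0 r :: (real^'m) set)"
  have v: "v > 0" unfolding v_def using r by (simp add: content_cball_pos)
  have bnd: "\<bar>integral\<^sup>L M (\<lambda>z. f (y + z) - f (x + z))\<bar> \<le> K * norm (y - x) * v"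
    unfolding M_def v_def by (rule averaged_difference_bound[OF lip ae convex_ball r sub])
  have fin: "finite_measure M" unfolding M_def by (intro finite_measure_lebesgue_on) auto
  have dz: "\<bar>(f y - f x) - (f (y + z) - f (x + z))\<bar> \<le> 2 * L * r" if "norm z \<le> r" for z
  proof -
    have in': "x + z \<in> cball c \<rho>" "y + z \<in> cball c \<rho>" "x \<in> cball c \<rho>" "y \<in> cball c \<rho>"
      using subsetD[OF sub(1), of "x + z"] subsetD[OF sub(2), of "y + z"] that xy
      by (auto simp: dist_norm)
    have "L * norm z \<le> L * r" using that L0 by (rule mult_left_mono)
    then show ?thesis
      using lipschitz_onD[OF L in'(1,3)] lipschitz_onD[OF L in'(2,4)] by (simp add: dist_real_def dist_norm)
  qed
  have cf: "continuous_on UNIV f" by (rule locally_lipschitz_continuous[OF lip])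
  have meas: "(\<lambda>z. (f y - f x) - (f (y + z) - f (x + z))) \<in> borel_measurable M"
    unfolding M_def
    by (rule continuous_imp_measurable_on_sets_lebesgue)
       (auto intro!: continuous_intros continuous_on_compose2[OF cf])
  have i1: "integrable M (\<lambda>z. (f y - f x) - (f (y + z) - f (x + z)))"
    by (rule finite_measure.integrable_const_bound[OF fin _ meas, where B = "2 * L * r"])
       (auto intro!: AE_I2 dz simp: M_def)
  have ic: "integrable M (\<lambda>z. a)" for a :: real using finite_measure.integrable_const[OF fin] .
  have i2: "integrable M (\<lambda>z. f (y + z) - f (x + z))"
    using Bochner_Integration.integrable_diff[OF ic[of "f y - f x"] i1] by simp
  have ival: "measure M (space M) = v"
    by (simp add: M_def v_def measure_restrict_space)
  have "\<bar>integral\<^sup>L M (\<lambda>z. (f y - f x) - (f (y + z) - f (x + z)))\<bar> \<le> 2 * L * r * v"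
  proof -
    have "\<bar>integral\<^sup>L M (\<lambda>z. (f y - f x) - (f (y + z) - f (x + z)))\<bar>
        \<le> integral\<^sup>L M (\<lambda>z. \<bar>(f y - f x) - (f (y + z) - f (x + z))\<bar>)"
      using integral_norm_bound[of M "\<lambda>z. (f y - f x) - (f (y + z) - f (x + z))"] by simp
    also have "\<dots> \<le> integral\<^sup>L M (\<lambda>z. 2 * L * r)"
      by (intro integral_mono ic integrable_abs[OF i1]) (use dz in \<open>auto simp: M_def\<close>)
    finally show ?thesis by (simp add: ival mult_ac)
  qed
  moreover have "integral\<^sup>L M (\<lambda>z. (f y - f x) - (f (y + z) - f (x + z)))
      = (f y - f x) * v - integral\<^sup>L M (\<lambda>z. f (y + z) - f (x + z))"
    by (subst Bochner_Integration.integral_diff[OF ic i2]) (simp add: ival mult.commute)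
  ultimately have "\<bar>(f y - f x) * v\<bar> \<le> (K * norm (y - x) + 2 * L * r) * v"
    using bnd by (simp add: algebra_simps abs_le_iff)
  then have "\<bar>f y - f x\<bar> * v \<le> (K * norm (y - x) + 2 * L * r) * v" using v by (simp add: abs_mult)
  then have "\<bar>f y - f x\<bar> \<le> K * norm (y - x) + 2 * L * r" using v by simp
  with Lr show "\<bar>f y - f x\<bar> \<le> K * norm (y - x) + e" by simp
qed

section \<open>Interior gradient estimate\<close>

text \<open>
  The mean value theorem gives convergence of difference quotients at moving base points, as
  needed for a sequence of maximum points.
\<close>

lemma difference_quotient_tendsto:
  fixes g :: "real^'m::finite \<Rightarrow> real"
  assumes g': "\<And>y. has_partial e g (g' y) y" and c: "isCont g' p"
    and t: "t \<longlonglongrightarrow> 0" "\<And>n. t n > 0" and x: "x \<longlonglongrightarrow> p"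
  shows "(\<lambda>n. (g (x n + t n *\<^sub>R axis e 1) - g (x n)) / t n) \<longlonglongrightarrow> g' p"
proof -
  have "\<exists>s. 0 < s \<and> s < t n \<and>
      (g (x n + t n *\<^sub>R axis e 1) - g (x n)) / t n = g' (x n + s *\<^sub>R axis e 1)" for n
  proof -
    obtain s where s: "0 < s" "s < t n" "g (x n + t n *\<^sub>R axis e 1) - g (x n + 0 *\<^sub>R axis e 1) =
        (t n - 0) * g' (x n + s *\<^sub>R axis e 1)"
      using MVT2[OF t(2)[of n], of "\<lambda>s. g (x n + s *\<^sub>R axis e 1)" "\<lambda>s. g' (x n + s *\<^sub>R axis e 1)"]
        has_partial_along_line[OF g'] by blast
    then show ?thesis using t(2)[of n] by (intro exI[of _ s]) (simp add: field_simps)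
  qed
  then obtain s where s: "\<And>n. 0 < s n" "\<And>n. s n < t n"
      "\<And>n. (g (x n + t n *\<^sub>R axis e 1) - g (x n)) / t n = g' (x n + s n *\<^sub>R axis e 1)"
    by metis
  have "s \<longlonglongrightarrow> 0"
    by (rule tendsto_sandwich[OF _ _ tendsto_const t(1)]) (use s in \<open>auto intro!: always_eventually less_imp_le\<close>)
  then have "(\<lambda>n. x n + s n *\<^sub>R axis e 1) \<longlonglongrightarrow> p + 0 *\<^sub>R axis e 1"
    by (intro tendsto_intros x)
  then have "(\<lambda>n. g' (x n + s n *\<^sub>R axis e 1)) \<longlonglongrightarrow> g' p"
    using c by (intro isCont_tendsto_compose[where g=g']) auto
  then show ?thesis by (simp add: s(3))
qed

text \<open>
  The first and second order conditions at a maximum of \<open>\<xi> ^ k * W\<close>, with \<open>W\<close> a sum of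
  squares. The power of the cut-off lets a common factor \<open>\<xi> ^ (k - 2)\<close> be divided out. In the second
  condition the first one eliminates the mixed terms in \<open>D\<xi> \<bullet> DW\<close>.
\<close>

lemma bernstein_at_cutoff_max:
  fixes v :: "'m::finite \<Rightarrow> real^'m \<Rightarrow> real" and c q :: "real^'m"
  assumes v1: "\<And>e i y. has_partial i (v e) (v1 e i y) y"
    and v2: "\<And>e i y. has_partial i (v1 e i) (v2 e i y) y"
    and k: "k \<ge> 2"
  defines "\<xi> \<equiv> \<lambda>y. 1 - (norm (y - c))\<^sup>2"
    and "W \<equiv> \<lambda>y. \<Sum>e\<in>UNIV. (v e y)\<^sup>2"
  assumes pos: "\<xi> q > 0"
    and mx: "\<And>y. y \<in> cball c 1 \<Longrightarrow> \<xi> y ^ k * W y \<le> \<xi> q ^ k * W q"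
  shows "\<xi> q * (\<Sum>e\<in>UNIV. v e q * v1 e i q) = real k * (q - c) $ i * W q"
    and "(\<xi> q)\<^sup>2 * ((\<Sum>i\<in>UNIV. \<Sum>e\<in>UNIV. (v1 e i q)\<^sup>2) + (\<Sum>i\<in>UNIV. \<Sum>e\<in>UNIV. v e q * v2 e i q))
        \<le> (2 * real k * (real k + 1) + real k * real CARD('m)) * W q"
proof -
  define W1 where "W1 = (\<lambda>i y. \<Sum>e\<in>UNIV. 2 * (v e y * v1 e i y))"
  define W2 where "W2 = (\<lambda>i y. \<Sum>e\<in>UNIV. 2 * ((v1 e i y)\<^sup>2 + v e y * v2 e i y))"
  have hW1: "has_partial i W (W1 i y) y" for i y
  proof -
    have "has_partial i W (\<Sum>e\<in>UNIV. real 2 * v e y ^ (2 - 1) * v1 e i y) y"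
      unfolding W_def by (intro has_partial_sum has_partial_power v1)
    then show ?thesis by (simp add: W1_def mult.assoc)
  qed
  have hW2: "has_partial i (W1 i) (W2 i y) y" for i y
  proof -
    have "has_partial i (W1 i) (\<Sum>e\<in>UNIV. 2 * (v e y * v2 e i y + v1 e i y * v1 e i y)) y"
      unfolding W1_def by (intro has_partial_sum has_partial_cmult has_partial_mult v1 v2)
    then show ?thesis by (simp add: W2_def power2_eq_square add.commute)
  qed
  have h\<xi>: "has_partial i \<xi> (- 2 * (y - c) $ i) y" for i y
    unfolding \<xi>_def using has_partial_diff[OF has_partial_const has_partial_norm_sq] by simp
  define X1 where "X1 = (\<lambda>i y. real k * \<xi> y ^ (k - 1) * (- 2 * (y - c) $ i))"
  define X2 where "X2 = (\<lambda>i y. real k * (\<xi> y ^ (k - 1) * - 2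
      + real (k - 1) * \<xi> y ^ (k - 1 - 1) * (- 2 * (y - c) $ i) * (- 2 * (y - c) $ i)))"
  have hX1: "has_partial i (\<lambda>y. \<xi> y ^ k) (X1 i y) y" for i y
    unfolding X1_def by (intro has_partial_power h\<xi>)
  have hX2: "has_partial i (X1 i) (X2 i y) y" for i y
  proof -
    have "has_partial i (\<lambda>y. - 2 * (y - c) $ i) (- 2 * (if i = i then 1 else 0)) y"
      by (intro has_partial_cmult has_partial_component)
    then have l: "has_partial i (\<lambda>y. - 2 * (y - c) $ i) (- 2) y" by simp
    show ?thesis unfolding X1_def X2_def mult.assoc[of "real k"]
      by (intro has_partial_cmult has_partial_mult has_partial_power h\<xi> l)
  qed
  have qb: "q \<in> ball c 1"
    using pos by (simp add: \<xi>_def dist_norm norm_minus_commute abs_square_less_1)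
  obtain r where r: "r > 0" "ball q r \<subseteq> ball c 1"
    using qb open_ball open_contains_ball by blast
  have mx': "\<xi> y ^ k * W y \<le> \<xi> q ^ k * W q" if "y \<in> ball q r" for y
    using that r mx[of y] ball_subset_cball[of c 1] by blast
  have G1: "has_partial i (\<lambda>y. \<xi> y ^ k * W y) (\<xi> y ^ k * W1 i y + X1 i y * W y) y" for i y
    by (intro has_partial_mult hX1 hW1)
  have G2: "has_partial i (\<lambda>y. \<xi> y ^ k * W1 i y + X1 i y * W y)
      ((\<xi> q ^ k * W2 i q + X1 i q * W1 i q) + (X1 i q * W1 i q + X2 i q * W q)) q" for i
    by (intro has_partial_add has_partial_mult hX1 hW1 hX2 hW2)
  note crit = local_max_grad_laplacian[OF r(1) G1 G2 mx']
  define z where "z = \<xi> q"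
  define P where "P = z ^ (k - 2)"
  have z: "z > 0" using pos by (simp add: z_def)
  have P: "P > 0" using z by (simp add: P_def)
  have zk: "z ^ k = P * z\<^sup>2" "z ^ (k - 1) = P * z" "z ^ (k - 1 - 1) = P"
  proof -
    have "k = (k - 2) + 2" "k - 1 = (k - 2) + 1" "k - 1 - 1 = k - 2" using k by auto
    then show "z ^ k = P * z\<^sup>2" "z ^ (k - 1) = P * z" "z ^ (k - 1 - 1) = P"
      unfolding P_def by (metis power_add, metis power_add power_one_right, metis)
  qed
  have k1: "real (k - 1) = real k - 1" using k by simp
  have first: "z * W1 i q = 2 * real k * (q - c) $ i * W q" for i
  proof -
    have "(P * z) * (z * W1 i q - 2 * real k * (q - c) $ i * W q) = 0"
      using crit(1)[of i] unfolding X1_def z_def[symmetric] zk by (simp add: power2_eq_square algebra_simps)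
    then show ?thesis using P z by simp
  qed
  then show "\<xi> q * (\<Sum>e\<in>UNIV. v e q * v1 e i q) = real k * (q - c) $ i * W q"
    by (simp add: W1_def z_def[symmetric] sum_distrib_left[symmetric])
  have W0: "W q \<ge> 0" by (simp add: W_def sum_nonneg)
  have summand: "(\<xi> q ^ k * W2 i q + X1 i q * W1 i q) + (X1 i q * W1 i q + X2 i q * W q)
     = P * (z\<^sup>2 * W2 i q - (4 * real k * (real k + 1) * ((q - c) $ i)\<^sup>2 + 2 * real k * z) * W q)" for i
  proof -
    have "X1 i q * W1 i q = P * (- 2 * real k * (q - c) $ i * (z * W1 i q))"
      unfolding X1_def z_def[symmetric] zk by (simp only: mult_ac)
    also have "\<dots> = P * (- 4 * (real k)\<^sup>2 * ((q - c) $ i)\<^sup>2 * W q)"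
      unfolding first by (simp add: power2_eq_square)
    finally have a: "X1 i q * W1 i q = P * (- 4 * (real k)\<^sup>2 * ((q - c) $ i)\<^sup>2 * W q)" .
    show ?thesis unfolding a X2_def z_def[symmetric] zk k1 by (simp add: power2_eq_square algebra_simps)
  qed
  have "P * (\<Sum>i\<in>UNIV. z\<^sup>2 * W2 i q - (4 * real k * (real k + 1) * ((q - c) $ i)\<^sup>2 + 2 * real k * z) * W q) \<le> 0"
    using crit(2) unfolding summand by (simp add: sum_distrib_left)
  then have "z\<^sup>2 * (\<Sum>i\<in>UNIV. W2 i q) \<le> (\<Sum>i\<in>UNIV. (4 * real k * (real k + 1) * ((q - c) $ i)\<^sup>2 + 2 * real k * z) * W q)"
    using P by (simp add: mult_le_0_iff sum_subtractf sum_distrib_left)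
  also have "\<dots> = (4 * real k * (real k + 1) * (norm (q - c))\<^sup>2 + 2 * real k * z * real CARD('m)) * W q"
    by (simp add: norm_sq_sum sum.distrib sum_distrib_left sum_distrib_right[symmetric] algebra_simps)
  also have "\<dots> \<le> (4 * real k * (real k + 1) * 1 + 2 * real k * 1 * real CARD('m)) * W q"
  proof (intro mult_right_mono add_mono mult_left_mono W0)
    show "z \<le> 1" by (simp add: z_def \<xi>_def)
    show "(norm (q - c))\<^sup>2 \<le> 1" using pos by (simp add: \<xi>_def)
  qed auto
  finally have "z\<^sup>2 * (\<Sum>i\<in>UNIV. W2 i q) \<le> (4 * real k * (real k + 1) * 1 + 2 * real k * 1 * real CARD('m)) * W q" .
  moreover have "(\<Sum>i\<in>UNIV. W2 i q) = 2 * ((\<Sum>i\<in>UNIV. \<Sum>e\<in>UNIV. (v1 e i q)\<^sup>2) + (\<Sum>i\<in>UNIV. \<Sum>e\<in>UNIV. v e q * v2 e i q))"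
    unfolding W2_def by (simp add: sum.distrib sum_distrib_left[symmetric])
  ultimately show "(\<xi> q)\<^sup>2 * ((\<Sum>i\<in>UNIV. \<Sum>e\<in>UNIV. (v1 e i q)\<^sup>2) + (\<Sum>i\<in>UNIV. \<Sum>e\<in>UNIV. v e q * v2 e i q))
        \<le> (2 * real k * (real k + 1) + real k * real CARD('m)) * W q"
    by (simp add: z_def[symmetric] algebra_simps)
qed

text \<open>
  Here \<open>z\<close> is the value of the cut-off \<open>1 - |q - x0|\<^sup>2\<close> at the limit \<open>q\<close> of maximum points of
  the cut-off sum of squared difference quotients of \<open>u\<close>. The difference quotient of the
  Laplacian is rewritten by the equation before the limit, so that no third derivative occurs; of
  \<open>F\<close> only the Lipschitz constant enters. The term with the gradient of \<open>H\<close> is handled by the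
  first-order condition and yields the middle summand; the Hessian term is bounded below
  by \<open>(\<Delta>u)\<^sup>2 / m\<close>.
\<close>

lemma bernstein_inequality:
  fixes u F :: "real^'m::finite \<Rightarrow> real"
  assumes u: "C_class 2 u"
    and eq: "\<And>y. - (1/2) * laplacian u y + (1/\<theta>) * norm (grad u y) powr \<theta> = F y"
    and \<theta>: "1 < \<theta>" and k: "k \<ge> 2"
    and F: "\<And>x y. x \<in> ball x0 2 \<Longrightarrow> y \<in> ball x0 2 \<Longrightarrow> \<bar>F x - F y\<bar> \<le> F1 * norm (x - y)"
    and nz: "grad u x0 \<noteq> 0"
  obtains q z where "q \<in> cball x0 1" "0 < z" "z \<le> 1"
    and "(norm (grad u x0))\<^sup>2 \<le> z ^ k * (norm (grad u q))\<^sup>2"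
    and "z\<^sup>2 * (laplacian u q)\<^sup>2 / real CARD('m)
      \<le> (2 * real k * (real k + 1) + real k * real CARD('m)) * (norm (grad u q))\<^sup>2
        + 2 * real k * z * norm (grad u q) powr (\<theta> + 1)
        + 2 * real CARD('m) * z\<^sup>2 * F1 * norm (grad u q)"
proof -
  define m where "m = real CARD('m)"
  define C1 where "C1 = 2 * real k * (real k + 1) + real k * m"
  define t where "t = (\<lambda>n. inverse (real (Suc n)))"
  define \<xi> where "\<xi> = (\<lambda>y. 1 - (norm (y - x0))\<^sup>2)"
  define H where "H = (\<lambda>y. (1/\<theta>) * norm (grad u y) powr \<theta>)"
  define b where "b = (\<lambda>y. norm (grad u y) powr (\<theta> - 2) *\<^sub>R grad u y)"
  define A where "A = (\<lambda>e i. partial_deriv e (partial_deriv i u))"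
  define Q where "Q = (\<lambda>n e (g :: real^'m \<Rightarrow> real) y. (g (y + t n *\<^sub>R axis e 1) - g y) / t n :: real)"
  define W where "W = (\<lambda>n y. \<Sum>e\<in>UNIV. (Q n e u y)\<^sup>2)"
  have t: "t n > 0" "t n \<le> 1" for n by (auto simp: t_def divide_simps)
  have t0: "t \<longlonglongrightarrow> 0" unfolding t_def by (rule LIMSEQ_inverse_real_of_nat)
  have hQ: "has_partial i (Q n e g) (Q n e (g' i) y) y"
    if "\<And>y. has_partial i g (g' i y) y" for n e g i y and g' :: "'m \<Rightarrow> real^'m \<Rightarrow> real"
  proof -
    have "has_partial i (\<lambda>y. (1 / t n) * (g (y + t n *\<^sub>R axis e 1) - g y))
       ((1 / t n) * (g' i (y + t n *\<^sub>R axis e 1) - g' i y)) y"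
      by (intro has_partial_cmult has_partial_diff has_partial_translate that)
    then show ?thesis by (simp add: Q_def)
  qed
  have v1: "has_partial i (Q n e u) (Q n e (\<lambda>y. grad u y $ i) y) y" for n e i y
    by (rule hQ[where g' = "\<lambda>i y. grad u y $ i"]) (rule C2_has_partial(1)[OF u])
  have v2: "has_partial i (Q n e (\<lambda>y. grad u y $ i)) (Q n e (A i i) y) y" for n e i y
    by (rule hQ[where g' = "\<lambda>i. A i i"]) (simp add: A_def C2_has_partial(3)[OF u])
  have cQ: "continuous_on UNIV (Q n e g)" if "continuous_on UNIV g" for n e g
    unfolding Q_def by (intro continuous_intros continuous_on_compose2[OF that] that) (use t(1)[of n] in auto)
  have c\<xi>: "continuous_on UNIV \<xi>" unfolding \<xi>_def by (intro continuous_intros)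
  have cG: "continuous_on UNIV (\<lambda>y. \<xi> y ^ k * W n y)" for n
    unfolding W_def by (intro continuous_intros c\<xi> cQ C2_continuous(1)[OF u])
  have "\<exists>q\<in>cball x0 1. \<forall>y\<in>cball x0 1. \<xi> y ^ k * W n y \<le> \<xi> q ^ k * W n q" for n
    using continuous_attains_sup[OF compact_cball _ continuous_on_subset[OF cG], of x0 1] by auto
  then obtain q where q: "\<And>n. q n \<in> cball x0 1"
    "\<And>n y. y \<in> cball x0 1 \<Longrightarrow> \<xi> y ^ k * W n y \<le> \<xi> (q n) ^ k * W n (q n)"
    by metis
  obtain l r where l: "l \<in> cball x0 1" "strict_mono r" "(q \<circ> r) \<longlonglongrightarrow> l"
    using compact_cball[of x0 1] q(1) unfolding compact_def by metis
  have tr: "(\<lambda>n. t (r n)) \<longlonglongrightarrow> 0"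
    using LIMSEQ_subseq_LIMSEQ[OF t0 l(2)] by (simp add: comp_def)
  have limQ: "(\<lambda>n. Q (r n) e g (x (r n))) \<longlonglongrightarrow> g' p"
    if "\<And>y. has_partial e g (g' y) y" "continuous_on UNIV g'" "(\<lambda>n. x (r n)) \<longlonglongrightarrow> p" for e g g' x p
    unfolding Q_def
    by (rule difference_quotient_tendsto[OF that(1) _ tr t(1) that(3)])
       (use that(2) in \<open>simp add: continuous_on_eq_continuous_at\<close>)
  have cgrad: "continuous_on UNIV (\<lambda>y. grad u y $ i)" for i
    by (intro continuous_intros C2_continuous(3)[OF u])
  have cA: "continuous_on UNIV (A e i)" for e i unfolding A_def by (rule C2D(3)[OF u])
  have cb: "continuous_on UNIV b" unfolding b_def by (rule gradient_drift_continuous[OF u \<theta>])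
  have ql: "(\<lambda>n. q (r n)) \<longlonglongrightarrow> l" using l(3) by (simp add: comp_def)
  have limv: "(\<lambda>n. Q (r n) e u (x (r n))) \<longlonglongrightarrow> grad u p $ e" if "(\<lambda>n. x (r n)) \<longlonglongrightarrow> p" for e x p
    by (rule limQ[OF _ cgrad that]) (rule C2_has_partial(1)[OF u])
  have limv1: "(\<lambda>n. Q (r n) e (\<lambda>y. grad u y $ i) (q (r n))) \<longlonglongrightarrow> A e i l" for e i
    by (rule limQ[OF _ cA ql]) (simp add: A_def C2_has_partial(3)[OF u])
  have limH: "(\<lambda>n. Q (r n) e H (q (r n))) \<longlonglongrightarrow> b l \<bullet> (\<chi> i. A e i l)" for e
  proof (rule limQ[OF _ _ ql])
    show "has_partial e H (b y \<bullet> (\<chi> i. A e i y)) y" for y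
      unfolding H_def b_def A_def by (rule C2_has_partial_norm_powr[OF u \<theta>])
    show "continuous_on UNIV (\<lambda>y. b y \<bullet> (\<chi> i. A e i y))"
      by (intro continuous_intros cb continuous_on_vec_lambda cA)
  qed
  have limW: "(\<lambda>n. W (r n) (x (r n))) \<longlonglongrightarrow> (norm (grad u p))\<^sup>2" if "(\<lambda>n. x (r n)) \<longlonglongrightarrow> p" for x p
    unfolding W_def norm_sq_sum by (intro tendsto_intros limv that)
  have lim\<xi>: "(\<lambda>n. \<xi> (q (r n))) \<longlonglongrightarrow> \<xi> l"
    using c\<xi> ql by (auto simp: continuous_on_eq_continuous_at intro: isCont_tendsto_compose)
  have val: "(norm (grad u x0))\<^sup>2 \<le> \<xi> l ^ k * (norm (grad u l))\<^sup>2"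
  proof (rule LIMSEQ_le)
    show "(\<lambda>n. W (r n) x0) \<longlonglongrightarrow> (norm (grad u x0))\<^sup>2" by (rule limW[where x = "\<lambda>n. x0"]) simp
    show "(\<lambda>n. \<xi> (q (r n)) ^ k * W (r n) (q (r n))) \<longlonglongrightarrow> \<xi> l ^ k * (norm (grad u l))\<^sup>2"
      by (intro tendsto_intros lim\<xi> limW ql)
    show "\<exists>N. \<forall>n\<ge>N. W (r n) x0 \<le> \<xi> (q (r n)) ^ k * W (r n) (q (r n))"
      using q(2)[of x0] by (auto simp: \<xi>_def)
  qed
  have \<xi>0: "\<xi> l \<noteq> 0" using val nz k by (auto simp: zero_power)
  have "norm (l - x0) \<le> 1" using l(1) by (simp add: dist_norm norm_minus_commute)
  then have "(norm (l - x0))\<^sup>2 \<le> 1" by (simp add: abs_square_le_1)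
  then have \<xi>pos: "\<xi> l > 0" using \<xi>0 by (simp add: \<xi>_def)
  have \<xi>1: "\<xi> y \<le> 1" for y by (simp add: \<xi>_def)
  have evpos: "eventually (\<lambda>n. \<xi> (q (r n)) > 0) sequentially"
    using order_tendstoD(1)[OF lim\<xi> \<xi>pos] .
  have lap: "(\<Sum>i\<in>UNIV. A i i y) = 2 * (H y - F y)" for y
    using eq[of y] by (simp add: laplacian_def A_def H_def)
  have first: "\<xi> l * (\<Sum>e\<in>UNIV. grad u l $ e * A e i l) = real k * (l - x0) $ i * (norm (grad u l))\<^sup>2" for i
  proof (rule tendsto_unique[OF sequentially_bot])
    let ?L = "\<lambda>n. \<xi> (q (r n)) * (\<Sum>e\<in>UNIV. Q (r n) e u (q (r n)) * Q (r n) e (\<lambda>y. grad u y $ i) (q (r n)))"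
    let ?R = "\<lambda>n. real k * (q (r n) - x0) $ i * W (r n) (q (r n))"
    show "?L \<longlonglongrightarrow> \<xi> l * (\<Sum>e\<in>UNIV. grad u l $ e * A e i l)"
      by (intro tendsto_intros lim\<xi> limv limv1 ql)
    have "eventually (\<lambda>n. ?R n = ?L n) sequentially"
      using evpos
    proof eventually_elim
      case (elim n)
      show ?case
        using bernstein_at_cutoff_max(1)[where v = "\<lambda>e. Q (r n) e u" and c = x0 and q = "q (r n)"
            and i = i, OF v1 v2 k] elim q(2)[of _ "r n"]
        by (simp add: \<xi>_def W_def)
    qed
    moreover have "?R \<longlonglongrightarrow> real k * (l - x0) $ i * (norm (grad u l))\<^sup>2"
      by (intro tendsto_intros limW ql)
    ultimately show "?L \<longlonglongrightarrow> real k * (l - x0) $ i * (norm (grad u l))\<^sup>2"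
      by (rule Lim_transform_eventually[rotated])
  qed
  have second: "(\<xi> l)\<^sup>2 * ((\<Sum>i\<in>UNIV. \<Sum>e\<in>UNIV. (A e i l)\<^sup>2)
        + 2 * (\<Sum>e\<in>UNIV. grad u l $ e * (b l \<bullet> (\<chi> i. A e i l))))
     \<le> C1 * (norm (grad u l))\<^sup>2 + 2 * (\<xi> l)\<^sup>2 * F1 * (\<Sum>e\<in>UNIV. \<bar>grad u l $ e\<bar>)"
  proof (rule tendsto_le[OF sequentially_bot])
    let ?L = "\<lambda>n. (\<xi> (q (r n)))\<^sup>2 * ((\<Sum>i\<in>UNIV. \<Sum>e\<in>UNIV. (Q (r n) e (\<lambda>y. grad u y $ i) (q (r n)))\<^sup>2)
        + 2 * (\<Sum>e\<in>UNIV. Q (r n) e u (q (r n)) * Q (r n) e H (q (r n))))"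
    let ?R = "\<lambda>n. C1 * W (r n) (q (r n)) + 2 * (\<xi> (q (r n)))\<^sup>2 * F1 * (\<Sum>e\<in>UNIV. \<bar>Q (r n) e u (q (r n))\<bar>)"
    show "?L \<longlonglongrightarrow> (\<xi> l)\<^sup>2 * ((\<Sum>i\<in>UNIV. \<Sum>e\<in>UNIV. (A e i l)\<^sup>2)
        + 2 * (\<Sum>e\<in>UNIV. grad u l $ e * (b l \<bullet> (\<chi> i. A e i l))))"
      by (intro tendsto_intros lim\<xi> limv limv1 limH ql)
    show "?R \<longlonglongrightarrow> C1 * (norm (grad u l))\<^sup>2 + 2 * (\<xi> l)\<^sup>2 * F1 * (\<Sum>e\<in>UNIV. \<bar>grad u l $ e\<bar>)"
      by (intro tendsto_intros lim\<xi> limv limW ql)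
    show "eventually (\<lambda>n. ?L n \<le> ?R n) sequentially"
      using evpos
    proof eventually_elim
      case (elim n)
      define N where "N = r n"
      define y where "y = q N"
      have y1: "y \<in> ball x0 1"
        using elim by (simp add: \<xi>_def y_def N_def dist_norm norm_minus_commute abs_square_less_1)
      have bern: "(\<xi> y)\<^sup>2 * ((\<Sum>i\<in>UNIV. \<Sum>e\<in>UNIV. (Q N e (\<lambda>y. grad u y $ i) y)\<^sup>2)
           + (\<Sum>i\<in>UNIV. \<Sum>e\<in>UNIV. Q N e u y * Q N e (A i i) y)) \<le> C1 * W N y"
        using bernstein_at_cutoff_max(2)[where v = "\<lambda>e. Q N e u" and c = x0 and q = y, OF v1 v2 k] elim q(2)[of _ "r n"]
        by (simp add: \<xi>_def W_def C1_def m_def y_def N_def)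
      have "(\<Sum>i\<in>UNIV. Q N e (A i i) y) = 2 * (Q N e H y - Q N e F y)" for e
      proof -
        have "(\<Sum>i\<in>UNIV. Q N e (A i i) y)
            = ((\<Sum>i\<in>UNIV. A i i (y + t N *\<^sub>R axis e 1)) - (\<Sum>i\<in>UNIV. A i i y)) / t N"
          unfolding Q_def by (simp only: sum_subtractf[symmetric] sum_divide_distrib)
        then show ?thesis unfolding lap by (simp add: Q_def diff_divide_distrib)
      qed
      then have sw: "(\<Sum>i\<in>UNIV. \<Sum>e\<in>UNIV. Q N e u y * Q N e (A i i) y)
          = 2 * (\<Sum>e\<in>UNIV. Q N e u y * Q N e H y) - 2 * (\<Sum>e\<in>UNIV. Q N e u y * Q N e F y)"
        by (subst sum.swap) (simp add: sum_distrib_left[symmetric] right_diff_distrib sum_subtractf mult.left_commute)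
      have QF: "\<bar>Q N e F y\<bar> \<le> F1" for e
      proof -
        have "dist x0 (y + t N *\<^sub>R axis e 1) \<le> dist x0 y + dist y (y + t N *\<^sub>R axis e 1)"
          by (rule dist_triangle)
        also have "\<dots> < 2" using y1 t[of N] by (simp add: dist_norm)
        finally have "\<bar>F (y + t N *\<^sub>R axis e 1) - F y\<bar> \<le> F1 * norm ((y + t N *\<^sub>R axis e 1) - y)"
          using y1 by (intro F) auto
        then show ?thesis using t[of N] by (simp add: Q_def divide_simps mult.commute)
      qed
      have "(\<Sum>e\<in>UNIV. Q N e u y * Q N e F y) \<le> (\<Sum>e\<in>UNIV. F1 * \<bar>Q N e u y\<bar>)"
      proof (rule sum_mono)
        fix e
        have "Q N e u y * Q N e F y \<le> \<bar>Q N e u y\<bar> * \<bar>Q N e F y\<bar>"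
          by (metis abs_ge_self abs_mult)
        also have "\<dots> \<le> \<bar>Q N e u y\<bar> * F1" by (intro mult_left_mono QF) auto
        finally show "Q N e u y * Q N e F y \<le> F1 * \<bar>Q N e u y\<bar>" by (simp add: mult.commute)
      qed
      then have "(\<xi> y)\<^sup>2 * (\<Sum>e\<in>UNIV. Q N e u y * Q N e F y) \<le> (\<xi> y)\<^sup>2 * (F1 * (\<Sum>e\<in>UNIV. \<bar>Q N e u y\<bar>))"
        by (intro mult_left_mono) (auto simp: sum_distrib_left)
      with bern show ?case unfolding sw N_def[symmetric] y_def[symmetric]
        by (simp add: algebra_simps)
    qed
  qed
  define P where "P = norm (grad u l)"
  have cross: "\<xi> l * (\<Sum>e\<in>UNIV. grad u l $ e * (b l \<bullet> (\<chi> i. A e i l))) \<ge> - (real k * P powr (\<theta> + 1))"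
  proof -
    have "\<xi> l * (\<Sum>e\<in>UNIV. grad u l $ e * (b l \<bullet> (\<chi> i. A e i l)))
        = (\<Sum>e\<in>UNIV. \<Sum>i\<in>UNIV. b l $ i * (\<xi> l * (grad u l $ e * A e i l)))"
      by (simp add: inner_vec_def sum_distrib_left mult_ac)
    also have "\<dots> = (\<Sum>i\<in>UNIV. b l $ i * (\<xi> l * (\<Sum>e\<in>UNIV. grad u l $ e * A e i l)))"
      by (subst sum.swap) (simp add: sum_distrib_left)
    also have "\<dots> = real k * P\<^sup>2 * (b l \<bullet> (l - x0))"
      unfolding first by (simp add: inner_vec_def sum_distrib_left P_def mult_ac)
    finally have e: "\<xi> l * (\<Sum>e\<in>UNIV. grad u l $ e * (b l \<bullet> (\<chi> i. A e i l))) = real k * P\<^sup>2 * (b l \<bullet> (l - x0))" .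
    have "\<bar>b l \<bullet> (l - x0)\<bar> \<le> P powr (\<theta> - 1) * norm (l - x0)"
      using Cauchy_Schwarz_ineq2[of "b l" "l - x0"]
      unfolding b_def norm_powr_gradient_norm[OF \<theta>] P_def .
    also have "\<dots> \<le> P powr (\<theta> - 1) * 1"
      using \<open>norm (l - x0) \<le> 1\<close> by (intro mult_left_mono) auto
    finally have "b l \<bullet> (l - x0) \<ge> - (P powr (\<theta> - 1))" by linarith
    then have "real k * P\<^sup>2 * (b l \<bullet> (l - x0)) \<ge> real k * P\<^sup>2 * (- (P powr (\<theta> - 1)))"
      by (intro mult_left_mono) auto
    moreover have "P\<^sup>2 * P powr (\<theta> - 1) = P powr (\<theta> + 1)"
    proof (cases "P = 0")
      case False
      then have "P powr 2 * P powr (\<theta> - 1) = P powr (\<theta> + 1)"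
        by (subst powr_add[symmetric]) (simp add: add.commute)
      then show ?thesis using False by (simp add: P_def)
    qed simp
    ultimately show ?thesis unfolding e by (simp add: mult.assoc)
  qed
  \<comment> \<open>Cauchy-Schwarz on the diagonal of the Hessian.\<close>
  have hess: "(laplacian u l)\<^sup>2 / m \<le> (\<Sum>i\<in>UNIV. \<Sum>e\<in>UNIV. (A e i l)\<^sup>2)"
  proof -
    have "(laplacian u l)\<^sup>2 \<le> (\<Sum>i\<in>UNIV. (A i i l)\<^sup>2) * m"
      using Cauchy_Schwarz_ineq_sum[of "\<lambda>i. A i i l" "\<lambda>i. 1" UNIV] by (simp add: laplacian_def A_def m_def)
    moreover have "(\<Sum>i\<in>UNIV. (A i i l)\<^sup>2) \<le> (\<Sum>i\<in>UNIV. \<Sum>e\<in>UNIV. (A e i l)\<^sup>2)"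
      by (intro sum_mono member_le_sum) auto
    moreover have "m > 0" by (simp add: m_def)
    ultimately show ?thesis
      by (simp add: divide_le_eq) (meson mult_right_mono less_imp_le order_trans)
  qed
  have l1: "(\<Sum>e\<in>UNIV. \<bar>grad u l $ e\<bar>) \<le> m * P"
    using sum_bounded_above[of UNIV "\<lambda>e. \<bar>grad u l $ e\<bar>" P] component_le_norm_cart[of "grad u l"]
    by (simp add: m_def P_def)
  have F1: "F1 \<ge> 0"
  proof -
    have "\<bar>F (x0 + axis undefined 1) - F x0\<bar> \<le> F1 * norm ((x0 + axis undefined 1) - x0)"
      by (rule F) (auto simp: dist_norm)
    then show ?thesis by simp
  qed
  have fin: "(\<xi> l)\<^sup>2 * (laplacian u l)\<^sup>2 / m
      \<le> C1 * P\<^sup>2 + 2 * real k * \<xi> l * P powr (\<theta> + 1) + 2 * m * (\<xi> l)\<^sup>2 * F1 * P"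
  proof -
    have a: "(\<xi> l)\<^sup>2 * ((laplacian u l)\<^sup>2 / m) \<le> (\<xi> l)\<^sup>2 * (\<Sum>i\<in>UNIV. \<Sum>e\<in>UNIV. (A e i l)\<^sup>2)"
      by (intro mult_left_mono hess) auto
    have c: "2 * \<xi> l * (\<xi> l * (\<Sum>e\<in>UNIV. grad u l $ e * (b l \<bullet> (\<chi> i. A e i l)))) \<ge> 2 * \<xi> l * (- (real k * P powr (\<theta> + 1)))"
      using cross \<xi>pos by (intro mult_left_mono) auto
    have d: "2 * (\<xi> l)\<^sup>2 * F1 * (\<Sum>e\<in>UNIV. \<bar>grad u l $ e\<bar>) \<le> 2 * (\<xi> l)\<^sup>2 * F1 * (m * P)"
      using F1 by (intro mult_left_mono l1) auto
    have e: "X\<^sup>2 * (S + 2 * T) = X\<^sup>2 * S + 2 * X * (X * T)" for X S T :: real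
      by (simp add: power2_eq_square algebra_simps)
    have f: "2 * X * - (real k * Y) = - (2 * real k * X * Y)" "2 * X\<^sup>2 * F1 * (m * P) = 2 * m * X\<^sup>2 * F1 * P"
        "X\<^sup>2 * (Y / m) = X\<^sup>2 * Y / m" for X Y :: real
      by simp_all
    show ?thesis using a c d second unfolding e f P_def[symmetric] by linarith
  qed
  show thesis
    using that[OF l(1) \<xi>pos \<xi>1 val] fin unfolding P_def C1_def m_def .
qed

text \<open>
  Set \<open>P = |Du q|\<close> and \<open>Z = z * P powr (\<theta> - 1)\<close> at the point \<open>q\<close> from \<open>bernstein_inequality\<close>. If
  \<open>P\<close> is large compared with \<open>A\<close>, the equation gives \<open>\<Delta>u \<ge> P powr \<theta> / \<theta>\<close>, and division by \<open>P\<^sup>2\<close>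
  leaves a quadratic inequality for \<open>Z\<close> with coefficients that depend on \<open>\<theta>\<close> and the dimension
  only. The exponent \<open>k \<ge> 2 / (\<theta> - 1)\<close> of the cut-off is what allows the value \<open>z ^ k * P\<^sup>2\<close> of the
  maximised function to be bounded by a power of \<open>Z\<close>.
\<close>

lemma gradient_bound:
  assumes \<theta>: "1 < \<theta>"
  shows "\<exists>K>0. \<forall>(u :: real^'m::finite \<Rightarrow> real) F x0 A.
     C_class 2 u \<longrightarrow> (\<forall>y. - (1/2) * laplacian u y + (1/\<theta>) * norm (grad u y) powr \<theta> = F y) \<longrightarrow>
     A \<ge> 1 \<longrightarrow> (\<forall>y\<in>ball x0 2. \<bar>F y\<bar> \<le> A powr \<theta>) \<longrightarrow>
     (\<forall>x\<in>ball x0 2. \<forall>y\<in>ball x0 2. \<bar>F x - F y\<bar> \<le> A powr \<theta> * norm (x - y)) \<longrightarrow>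
     norm (grad u x0) \<le> K * A"
proof -
  define m where "m = real CARD('m)"
  define k where "k = nat \<lceil>2 / (\<theta> - 1)\<rceil> + 2"
  define C1 where "C1 = 2 * real k * (real k + 1) + real k * m"
  \<comment> \<open>The first two summands make \<open>A powr \<theta>\<close> absorbable, in the equation and in the Lipschitz term respectively.\<close>
  define k0 where "k0 = 2 * \<theta> + 4 * m\<^sup>2 * \<theta>\<^sup>2 + 1"
  \<comment> \<open>A bound for the solutions \<open>Z\<close> of the quadratic inequality \<open>Z\<^sup>2 \<le> 2 m \<theta>\<^sup>2 (C1 + 2 k Z)\<close>.\<close>
  define Z0 where "Z0 = 1 + 2 * m * \<theta>\<^sup>2 * (C1 + 2 * real k)"
  define K where "K = max k0 (Z0 powr (1 / (\<theta> - 1)))"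
  have m: "m \<ge> 1" by (simp add: m_def Suc_leI)
  have k: "k \<ge> 2" "real k \<ge> 2 / (\<theta> - 1)" by (simp add: k_def) (simp add: k_def, linarith)
  have k0: "k0 \<ge> 2 * \<theta>" "k0 \<ge> 4 * m\<^sup>2 * \<theta>\<^sup>2" "k0 \<ge> 1" using \<theta> by (simp_all add: k0_def)
  have C1: "C1 \<ge> 0" using m by (simp add: C1_def)
  have Z0: "Z0 \<ge> 1" using C1 m by (simp add: Z0_def)
  have K0: "K > 0" using k0 by (auto simp: K_def)
  have k0\<theta>: "k0 \<le> k0 powr \<theta>" using powr_mono[of 1 \<theta> k0] \<theta> k0 by simp
  have "norm (grad u x0) \<le> K * A"
    if u: "C_class 2 u"
      and eq: "\<And>y. - (1/2) * laplacian u y + (1/\<theta>) * norm (grad u y) powr \<theta> = F y"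
      and A: "A \<ge> 1" and Fb: "\<And>y. y \<in> ball x0 2 \<Longrightarrow> \<bar>F y\<bar> \<le> A powr \<theta>"
      and Fl: "\<And>x y. x \<in> ball x0 2 \<Longrightarrow> y \<in> ball x0 2 \<Longrightarrow> \<bar>F x - F y\<bar> \<le> A powr \<theta> * norm (x - y)"
    for u F and x0 :: "real^'m" and A
  proof (cases "grad u x0 = 0")
    case True then show ?thesis using K0 A by simp
  next
    case False
    obtain q z where q: "q \<in> cball x0 1" and z: "0 < z" "z \<le> 1"
      and val: "(norm (grad u x0))\<^sup>2 \<le> z ^ k * (norm (grad u q))\<^sup>2"
      and ineq: "z\<^sup>2 * (laplacian u q)\<^sup>2 / m
        \<le> C1 * (norm (grad u q))\<^sup>2 + 2 * real k * z * norm (grad u q) powr (\<theta> + 1)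
          + 2 * m * z\<^sup>2 * A powr \<theta> * norm (grad u q)"
      using bernstein_inequality[OF u eq \<theta> k(1) Fl False] unfolding C1_def m_def by blast
    define P where "P = norm (grad u q)"
    show ?thesis
    proof (cases "P \<le> k0 * A")
      case True
      have "z ^ k * P\<^sup>2 \<le> 1 * P\<^sup>2" using z by (intro mult_right_mono power_le_one) auto
      then have "(norm (grad u x0))\<^sup>2 \<le> P\<^sup>2" using val unfolding P_def by linarith
      then have "norm (grad u x0) \<le> P" by (rule power2_le_imp_le) (simp add: P_def)
      also note True
      also have "k0 * A \<le> K * A" using A by (intro mult_right_mono) (auto simp: K_def)
      finally show ?thesis .
    next
      case False
      then have PA: "P > k0 * A" by simp
      moreover have "k0 * A \<ge> 1 * 1" using k0 A by (intro mult_mono) auto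
      ultimately have P1: "P > 1" by simp
      have AP: "k0 * A powr \<theta> \<le> P powr \<theta>"
      proof -
        have "k0 * A powr \<theta> \<le> k0 powr \<theta> * A powr \<theta>" by (intro mult_right_mono k0\<theta>) auto
        also have "\<dots> = (k0 * A) powr \<theta>" using k0 A by (simp add: powr_mult)
        also have "\<dots> \<le> P powr \<theta>" using PA \<theta> k0 A by (intro powr_mono2) auto
        finally show ?thesis .
      qed
      have Lap: "laplacian u q \<ge> P powr \<theta> / \<theta>"
      proof -
        have "\<bar>F q\<bar> \<le> A powr \<theta>" using q by (intro Fb) auto
        moreover have "2 * \<theta> * A powr \<theta> \<le> P powr \<theta>"
          using AP mult_right_mono[OF k0(1), of "A powr \<theta>"] by simp
        then have "A powr \<theta> \<le> P powr \<theta> / \<theta> / 2" using \<theta> by (simp add: field_simps)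
        moreover have "laplacian u q = 2 * (P powr \<theta> / \<theta> - F q)" using eq[of q] by (simp add: P_def)
        ultimately show ?thesis by (simp add: abs_le_iff)
      qed
      define Z where "Z = z * P powr (\<theta> - 1)"
      have Zpos: "Z \<ge> 0" using z by (simp add: Z_def)
      have pw: "P powr (\<theta> + 1) = P\<^sup>2 * P powr (\<theta> - 1)" "P powr \<theta> = P * P powr (\<theta> - 1)"
      proof -
        have "P powr 2 * P powr (\<theta> - 1) = P powr (\<theta> + 1)"
          by (subst powr_add[symmetric]) (simp add: add.commute)
        then show "P powr (\<theta> + 1) = P\<^sup>2 * P powr (\<theta> - 1)" using P1 by simp
        have "P powr 1 * P powr (\<theta> - 1) = P powr \<theta>"
          by (subst powr_add[symmetric]) simp
        then show "P powr \<theta> = P * P powr (\<theta> - 1)" using P1 by simp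
      qed
      have lhs: "P\<^sup>2 * (Z\<^sup>2 / (m * \<theta>\<^sup>2)) \<le> z\<^sup>2 * (laplacian u q)\<^sup>2 / m"
      proof -
        have "(P powr \<theta> / \<theta>)\<^sup>2 \<le> (laplacian u q)\<^sup>2" using Lap \<theta> by (intro power_mono) auto
        then have "z\<^sup>2 * (P powr \<theta> / \<theta>)\<^sup>2 / m \<le> z\<^sup>2 * (laplacian u q)\<^sup>2 / m"
          using m by (intro divide_right_mono mult_left_mono) auto
        moreover have "z\<^sup>2 * (P powr \<theta> / \<theta>)\<^sup>2 / m = P\<^sup>2 * (Z\<^sup>2 / (m * \<theta>\<^sup>2))"
          unfolding pw(2) Z_def using m \<theta> by (simp add: power_mult_distrib power_divide mult_ac)
        ultimately show ?thesis by simp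
      qed
      have third: "2 * m * z\<^sup>2 * A powr \<theta> * P \<le> P\<^sup>2 * (Z\<^sup>2 / (2 * m * \<theta>\<^sup>2))"
      proof -
        have "4 * m\<^sup>2 * \<theta>\<^sup>2 * A powr \<theta> \<le> P powr \<theta>"
          using AP mult_right_mono[OF k0(2), of "A powr \<theta>"] by simp
        also have "\<dots> = P * P powr (\<theta> - 1) * 1" by (simp add: pw(2))
        also have "\<dots> \<le> P * P powr (\<theta> - 1) * P powr (\<theta> - 1)"
          using P1 \<theta> by (intro mult_left_mono ge_one_powr_ge_zero) auto
        finally have "4 * m\<^sup>2 * \<theta>\<^sup>2 * A powr \<theta> \<le> P * (P powr (\<theta> - 1))\<^sup>2" by (simp add: power2_eq_square)
        then have "(4 * m\<^sup>2 * \<theta>\<^sup>2 * A powr \<theta>) * (z\<^sup>2 * P) \<le> (P * (P powr (\<theta> - 1))\<^sup>2) * (z\<^sup>2 * P)"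
          using P1 by (intro mult_right_mono) auto
        then have "(2 * m * z\<^sup>2 * A powr \<theta> * P) * (2 * m * \<theta>\<^sup>2) \<le> P\<^sup>2 * Z\<^sup>2"
          by (simp add: Z_def power2_eq_square algebra_simps)
        then show ?thesis using m \<theta> by (simp add: field_simps)
      qed
      have "P\<^sup>2 * (Z\<^sup>2 / (m * \<theta>\<^sup>2)) \<le> P\<^sup>2 * (C1 + 2 * real k * Z + Z\<^sup>2 / (2 * m * \<theta>\<^sup>2))"
        using lhs ineq third unfolding P_def[symmetric] pw(1) by (simp add: Z_def algebra_simps)
      then have "Z\<^sup>2 / (m * \<theta>\<^sup>2) \<le> C1 + 2 * real k * Z + Z\<^sup>2 / (2 * m * \<theta>\<^sup>2)"
        by (rule mult_left_le_imp_le) (use P1 in simp)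
      then have Zq: "Z\<^sup>2 \<le> 2 * m * \<theta>\<^sup>2 * (C1 + 2 * real k * Z)" using m \<theta> by (simp add: field_simps)
      have "Z \<le> Z0"
      proof (cases "Z \<le> 1")
        case True then show ?thesis using Z0 by simp
      next
        case False
        have "C1 + 2 * real k * Z \<le> (C1 + 2 * real k) * Z"
          using False C1 mult_left_mono[of 1 Z C1] by (simp add: algebra_simps)
        then have "2 * m * \<theta>\<^sup>2 * (C1 + 2 * real k * Z) \<le> 2 * m * \<theta>\<^sup>2 * ((C1 + 2 * real k) * Z)"
          using m by (intro mult_left_mono) auto
        with Zq have "Z * Z \<le> (2 * m * \<theta>\<^sup>2 * (C1 + 2 * real k)) * Z" by (simp add: power2_eq_square mult.assoc)
        then have "Z \<le> 2 * m * \<theta>\<^sup>2 * (C1 + 2 * real k)" using False by simp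
        then show ?thesis by (simp add: Z0_def)
      qed
      define s where "s = 2 / (\<theta> - 1)"
      have s: "s > 0" using \<theta> by (simp add: s_def)
      have "z ^ k * P\<^sup>2 \<le> z powr s * P\<^sup>2"
      proof (rule mult_right_mono)
        have "z powr real k \<le> z powr s" using z k(2) by (intro powr_mono') (auto simp: s_def)
        then show "z ^ k \<le> z powr s" using z by (simp add: powr_realpow)
      qed simp
      also have "\<dots> = Z powr s"
      proof -
        have "(\<theta> - 1) * s = 2"
          unfolding s_def times_divide_eq_right by (rule nonzero_mult_div_cancel_left) (use \<theta> in simp)
        then have "(P powr (\<theta> - 1)) powr s = P powr 2" by (simp only: powr_powr)
        then show ?thesis using z P1 by (simp add: Z_def powr_mult)
      qed
      also have "\<dots> \<le> Z0 powr s" using \<open>Z \<le> Z0\<close> Zpos s by (intro powr_mono2) auto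
      also have "\<dots> = (Z0 powr (1 / (\<theta> - 1)))\<^sup>2"
        unfolding power2_eq_square powr_add[symmetric] s_def by (simp add: add_divide_distrib[symmetric])
      finally have "(norm (grad u x0))\<^sup>2 \<le> (Z0 powr (1 / (\<theta> - 1)))\<^sup>2" using val unfolding P_def by linarith
      then have "norm (grad u x0) \<le> Z0 powr (1 / (\<theta> - 1))" by (rule power2_le_imp_le) simp
      also have "\<dots> \<le> K * 1" by (simp add: K_def)
      also have "\<dots> \<le> K * A" using K0 A by (intro mult_left_mono) auto
      finally show ?thesis .
    qed
  qed
  with K0 show ?thesis by blast
qed

section \<open>Growth of solutions that are bounded below\<close>

text \<open>
  Where \<open>a (R\<^sup>2 - |y - y0|\<^sup>2) - u\<close> has an interior maximum, the gradient of \<open>u\<close> and its Laplacian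
  are too small for the right-hand side \<open>F\<close>; so the maximum lies on the sphere, where the
  paraboloid vanishes.
\<close>

lemma paraboloid_barrier:
  fixes u F :: "real^'m::finite \<Rightarrow> real"
  assumes u: "C_class 2 u"
    and eq: "\<And>y. - (1/2) * laplacian u y + (1/\<theta>) * norm (grad u y) powr \<theta> = F y"
    and \<theta>: "\<theta> > 0" and a: "a \<ge> 0" and R: "R > 0"
    and F: "\<And>y. y \<in> ball y0 R \<Longrightarrow> F y > a * real CARD('m) + (1/\<theta>) * (2 * a * R) powr \<theta>"
    and lb: "\<And>y. m0 \<le> u y"
  shows "u y0 \<ge> m0 + a * R\<^sup>2"
proof -
  define g where "g = (\<lambda>y. a * (R\<^sup>2 - (norm (y - y0))\<^sup>2) - u y)"
  have cg: "continuous_on (cball y0 R) g"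
    unfolding g_def
    by (intro continuous_intros continuous_on_subset[OF C2_continuous(1)[OF u]]) auto
  obtain q where q: "q \<in> cball y0 R" "\<And>y. y \<in> cball y0 R \<Longrightarrow> g y \<le> g q"
    using continuous_attains_sup[OF compact_cball _ cg] R by auto
  have "q \<notin> ball y0 R"
  proof
    assume qb: "q \<in> ball y0 R"
    then obtain r where r: "r > 0" "ball q r \<subseteq> ball y0 R"
      using open_ball open_contains_ball by blast
    have g1: "has_partial i g (a * (0 - 2 * (y - y0) $ i) - grad u y $ i) y" for i y
      unfolding g_def
      by (intro has_partial_diff has_partial_cmult has_partial_const has_partial_norm_sq C2_has_partial[OF u])
    have g2: "has_partial i (\<lambda>y. a * (0 - 2 * (y - y0) $ i) - grad u y $ i)
        (a * (0 - 2 * (if i = i then 1 else 0)) - partial_deriv i (partial_deriv i u) q) q" for i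
      by (intro has_partial_diff has_partial_cmult has_partial_const has_partial_component C2_has_partial[OF u])
    have mx: "g y \<le> g q" if "y \<in> ball q r" for y
      using that r q(2)[of y] ball_subset_cball[of y0 R] by blast
    note crit = local_max_grad_laplacian[OF r(1) g1 g2 mx]
    have "grad u q = (- 2 * a) *\<^sub>R (q - y0)"
      using crit(1) by (simp add: vec_eq_iff algebra_simps)
    then have "norm (grad u q) = 2 * a * norm (q - y0)" using a by simp
    also have "\<dots> \<le> 2 * a * R" using qb a by (intro mult_left_mono) (auto simp: dist_norm norm_minus_commute)
    finally have "norm (grad u q) powr \<theta> \<le> (2 * a * R) powr \<theta>"
      using \<theta> by (intro powr_mono2) auto
    moreover have "- (1/2) * laplacian u q \<le> a * real CARD('m)"
    proof -
      have "- (2 * (a * real CARD('m))) \<le> laplacian u q"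
        using crit(2) by (simp add: laplacian_def sum_subtractf sum_negf mult_ac)
      then show ?thesis by linarith
    qed
    ultimately have "F q \<le> a * real CARD('m) + (1/\<theta>) * (2 * a * R) powr \<theta>"
      unfolding eq[symmetric] using \<theta> by (intro add_mono mult_left_mono) auto
    with F[OF qb] show False by simp
  qed
  then have "norm (q - y0) = R" using q(1) by (auto simp: dist_norm norm_minus_commute)
  then have "g q \<le> - m0" using lb[of q] by (simp add: g_def)
  moreover have "g y0 \<le> g q" using q(2) R by simp
  ultimately show ?thesis by (simp add: g_def)
qed

lemma powr_eventually_greater:
  fixes s B :: real
  assumes "s > 0"
  shows "eventually (\<lambda>x::real. x powr s > B) at_top"
  unfolding eventually_at_top_linorder
proof (intro exI[of _ "(\<bar>B\<bar> + 1) powr (1/s)"] allI impI)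
  fix x :: real assume "(\<bar>B\<bar> + 1) powr (1/s) \<le> x"
  then have "((\<bar>B\<bar> + 1) powr (1/s)) powr s \<le> x powr s"
    using assms by (intro powr_mono2) auto
  then show "B < x powr s" using assms by (simp add: powr_powr)
qed

text \<open>
  The barrier on the ball of radius \<open>\<rho> = |y|/2\<close> around \<open>y\<close> is taken with slope of order
  \<open>\<rho> powr (\<alpha>/\<theta>)\<close>: this is the largest order for which the nonlinear term stays below
  \<open>f \<ge> \<kappa> \<rho> powr \<alpha>\<close>, while the second-order term has the lower order \<open>\<rho> powr (\<alpha>/\<theta> - 1)\<close>.
\<close>

lemma bounded_below_solution_growth:
  fixes u f :: "real^'m::finite \<Rightarrow> real"
  assumes u: "C_class 2 u"
    and eq: "\<And>y. - (1/2) * laplacian u y + (1/\<theta>) * norm (grad u y) powr \<theta> = f y - \<mu>"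
    and \<theta>: "1 < \<theta>" and \<alpha>: "\<alpha> > 0" and \<kappa>: "\<kappa> > 0"
    and f: "\<And>y. \<kappa> * norm y powr \<alpha> \<le> f y"
    and lb: "\<And>y. m0 \<le> u y"
  shows "\<exists>c>0. eventually (\<lambda>\<rho>. \<forall>y. norm y = \<rho> \<longrightarrow> c * \<rho> powr (1 + \<alpha>/\<theta>) \<le> u y) at_top"
proof -
  define \<gamma> where "\<gamma> = 1 + \<alpha> / \<theta>"
  define m where "m = real CARD('m)"
  \<comment> \<open>\<open>\<epsilon> \<le> 1/2\<close> allows \<open>(2 \<epsilon>) powr \<theta> \<le> 2 \<epsilon>\<close>; the other bound keeps the barrier below half of \<open>f\<close>.\<close>
  define \<epsilon> where "\<epsilon> = min (1/2) (\<kappa> / (2 * (m + 2)))"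
  have m: "m \<ge> 0" by (simp add: m_def)
  have \<gamma>: "\<gamma> > 1" using \<alpha> \<theta> by (simp add: \<gamma>_def)
  have e: "\<epsilon> > 0" "\<epsilon> \<le> 1/2" "\<epsilon> * (m + 2) \<le> \<kappa> / 2"
  proof -
    show "\<epsilon> > 0" using \<kappa> m by (simp add: \<epsilon>_def)
    show "\<epsilon> \<le> 1/2" unfolding \<epsilon>_def by (rule min.cobounded1)
    have "\<epsilon> * (m + 2) \<le> \<kappa> / (2 * (m + 2)) * (m + 2)"
      using m by (intro mult_right_mono) (auto simp: \<epsilon>_def)
    also have "\<dots> = \<kappa> / 2" using m by (simp add: field_simps)
    finally show "\<epsilon> * (m + 2) \<le> \<kappa> / 2" .
  qed
  have ev: "eventually (\<lambda>\<rho>::real. \<rho> \<ge> 1 \<and> \<rho> powr \<alpha> > 2 * \<mu> / \<kappa> \<and> \<rho> powr \<gamma> > - 2 * m0 / \<epsilon>) at_top"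
    using powr_eventually_greater[OF \<alpha>, of "2 * \<mu> / \<kappa>"]
      powr_eventually_greater[of \<gamma> "- 2 * m0 / \<epsilon>"] \<gamma> eventually_ge_at_top[of "1::real"]
    by (auto intro: eventually_conj)
  have main: "\<epsilon> / 2 * \<rho> powr \<gamma> \<le> u y"
    if \<rho>: "\<rho> \<ge> 1" "\<rho> powr \<alpha> > 2 * \<mu> / \<kappa>" "\<rho> powr \<gamma> > - 2 * m0 / \<epsilon>" and y: "norm y = 2 * \<rho>" for \<rho> y
  proof -
    define a where "a = \<epsilon> * \<rho> powr (\<gamma> - 2)"
    have a: "a \<ge> 0" using e by (simp add: a_def)
    have "\<rho> powr (\<gamma> - 2) \<le> \<rho> powr \<alpha>"
    proof (rule powr_mono)
      have "\<alpha> / \<theta> \<le> \<alpha>" using \<alpha> \<theta> by (simp add: field_simps)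
      then show "\<gamma> - 2 \<le> \<alpha>" by (simp add: \<gamma>_def)
    qed (use \<rho> in auto)
    then have am: "a * m \<le> \<epsilon> * m * \<rho> powr \<alpha>"
      using mult_left_mono[of "\<rho> powr (\<gamma> - 2)" "\<rho> powr \<alpha>" "\<epsilon> * m"] e m by (simp add: a_def mult_ac)
    have "2 * a * \<rho> = 2 * \<epsilon> * \<rho> powr (\<alpha>/\<theta>)"
    proof -
      have "\<rho> powr (\<gamma> - 2) * \<rho> powr 1 = \<rho> powr (\<alpha> / \<theta>)"
        by (subst powr_add[symmetric]) (simp add: \<gamma>_def)
      then show ?thesis using \<rho> by (simp add: a_def)
    qed
    moreover have "(2 * \<epsilon> * \<rho> powr (\<alpha>/\<theta>)) powr \<theta> = (2 * \<epsilon>) powr \<theta> * \<rho> powr \<alpha>"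
      using e \<theta> by (subst powr_mult) (auto simp: powr_powr)
    ultimately have "(2 * a * \<rho>) powr \<theta> = (2 * \<epsilon>) powr \<theta> * \<rho> powr \<alpha>" by (simp only:)
    also have "\<dots> \<le> (2 * \<epsilon>) powr 1 * \<rho> powr \<alpha>"
      using e \<theta> by (intro mult_right_mono powr_mono') auto
    finally have pw: "(2 * a * \<rho>) powr \<theta> \<le> 2 * \<epsilon> * \<rho> powr \<alpha>" using e by simp
    have pw': "(1/\<theta>) * (2 * a * \<rho>) powr \<theta> \<le> 2 * \<epsilon> * \<rho> powr \<alpha>"
    proof -
      have "(1/\<theta>) * (2 * a * \<rho>) powr \<theta> \<le> 1 * (2 * a * \<rho>) powr \<theta>"
        using \<theta> by (intro mult_right_mono) auto
      with pw show ?thesis by simp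
    qed
    have total: "a * m + (1/\<theta>) * (2 * a * \<rho>) powr \<theta> \<le> \<kappa> / 2 * \<rho> powr \<alpha>"
    proof -
      have "a * m + (1/\<theta>) * (2 * a * \<rho>) powr \<theta> \<le> \<epsilon> * (m + 2) * \<rho> powr \<alpha>"
        using am pw' by (simp add: algebra_simps)
      also have "\<dots> \<le> \<kappa> / 2 * \<rho> powr \<alpha>" using e(3) by (rule mult_right_mono) auto
      finally show ?thesis .
    qed
    have "m0 + a * \<rho>\<^sup>2 \<le> u y"
    proof (rule paraboloid_barrier[OF u eq _ a])
      fix z assume "z \<in> ball y \<rho>"
      then have "norm (y - z) < \<rho>" by (simp add: dist_norm)
      then have nz: "\<rho> \<le> norm z" using y norm_triangle_ineq2[of y z] by linarith
      then have "\<kappa> * \<rho> powr \<alpha> \<le> \<kappa> * norm z powr \<alpha>"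
        using \<rho> \<alpha> \<kappa> by (intro mult_left_mono powr_mono2) auto
      moreover have "\<mu> < \<kappa> / 2 * \<rho> powr \<alpha>" using \<rho>(2) \<kappa> by (simp add: field_simps)
      ultimately show "f z - \<mu> > a * real CARD('m) + (1/\<theta>) * (2 * a * \<rho>) powr \<theta>"
        using f[of z] total unfolding m_def by linarith
    qed (use \<theta> \<rho> lb in auto)
    moreover have "a * \<rho>\<^sup>2 = \<epsilon> * \<rho> powr \<gamma>"
    proof -
      have "\<rho> powr (\<gamma> - 2) * \<rho> powr 2 = \<rho> powr \<gamma>"
        by (subst powr_add[symmetric]) simp
      then show ?thesis using \<rho> by (simp add: a_def)
    qed
    moreover have "- m0 \<le> \<epsilon> / 2 * \<rho> powr \<gamma>" using \<rho>(3) e by (simp add: field_simps)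
    ultimately show ?thesis by simp
  qed
  show ?thesis
  proof (intro exI conjI)
    show "\<epsilon> / 2 * (1/2) powr \<gamma> > 0" using e by simp
    from ev obtain N where N: "\<And>\<rho>. \<rho> \<ge> N \<Longrightarrow> \<rho> \<ge> 1 \<and> \<rho> powr \<alpha> > 2 * \<mu> / \<kappa> \<and> \<rho> powr \<gamma> > - 2 * m0 / \<epsilon>"
      unfolding eventually_at_top_linorder by blast
    show "eventually (\<lambda>\<rho>. \<forall>y. norm y = \<rho> \<longrightarrow> \<epsilon> / 2 * (1/2) powr \<gamma> * \<rho> powr (1 + \<alpha>/\<theta>) \<le> u y) at_top"
      unfolding eventually_at_top_linorder
    proof (intro exI[of _ "2 * N"] allI impI)
      fix \<rho> and y :: "real^'m" assume r: "2 * N \<le> \<rho>" "norm y = \<rho>"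
      have "\<epsilon> / 2 * (\<rho> / 2) powr \<gamma> \<le> u y"
        using main[of "\<rho>/2" y] N[of "\<rho> / 2"] r by auto
      moreover have "(1/2) powr \<gamma> * \<rho> powr \<gamma> = (\<rho> / 2) powr \<gamma>"
        using powr_mult[of "1/2" \<rho> \<gamma>] r norm_ge_zero[of y] by simp
      ultimately show "\<epsilon> / 2 * (1/2) powr \<gamma> * \<rho> powr (1 + \<alpha>/\<theta>) \<le> u y"
        by (simp add: \<gamma>_def[symmetric] mult.assoc)
    qed
  qed
qed

text \<open>
  One rate \<open>|c| powr \<alpha>\<close> is used for all \<open>\<alpha>\<close>. It is cruder than the rate assumed for the gradient,
  but the gradient estimate tolerates Lipschitz constants of the same order as \<open>f\<close> itself.
\<close>

lemma H0_lipschitz_on_ball: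
  fixes f :: "real^'m::finite \<Rightarrow> real"
  assumes H0: "H0 \<alpha> f0 f" and \<alpha>: "\<alpha> > 0" and f0: "f0 > 0"
    and xy: "x \<in> ball c 2" "y \<in> ball c 2"
  shows "\<bar>f x - f y\<bar> \<le> f0 * (2 + (norm c + 2) powr \<alpha>) * norm (x - y)"
proof -
  have pt: "norm (grad f p) \<le> f0 * (2 + (norm c + 2) powr \<alpha>)"
    if p: "p \<in> ball c 2" and g: "(\<alpha> \<ge> 1 \<and> norm (grad f p) \<le> f0 * (1 + norm p powr (\<alpha> - 1)))
        \<or> (\<alpha> < 1 \<and> norm (grad f p) \<le> f0)" for p
  proof -
    define s where "s = norm c + 2"
    have ps: "norm p \<le> s"
      using p norm_triangle_ineq2[of p c] by (simp add: s_def dist_norm norm_minus_commute)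
    have s1: "s \<ge> 1" by (simp add: s_def)
    from g have "norm (grad f p) \<le> f0 * (2 + s powr \<alpha>)"
    proof
      assume a: "\<alpha> \<ge> 1 \<and> norm (grad f p) \<le> f0 * (1 + norm p powr (\<alpha> - 1))"
      have "norm p powr (\<alpha> - 1) \<le> s powr (\<alpha> - 1)" using a ps by (intro powr_mono2) auto
      also have "\<dots> \<le> s powr \<alpha>" using s1 by (intro powr_mono) auto
      finally have "f0 * (1 + norm p powr (\<alpha> - 1)) \<le> f0 * (2 + s powr \<alpha>)"
        using f0 by (intro mult_left_mono) auto
      with a show ?thesis by simp
    next
      assume a: "\<alpha> < 1 \<and> norm (grad f p) \<le> f0"
      have "f0 * 1 \<le> f0 * (2 + s powr \<alpha>)" using f0 by (intro mult_left_mono) auto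
      with a show ?thesis by simp
    qed
    then show ?thesis by (simp add: s_def)
  qed
  have ae: "AE p in lebesgue. p \<in> ball c 2 \<longrightarrow>
      f differentiable at p \<and> norm (grad f p) \<le> f0 * (2 + (norm c + 2) powr \<alpha>)"
  proof (cases "\<alpha> \<ge> 1")
    case True
    with H0 have "AE p in lebesgue. f differentiable at p \<and> norm (grad f p) \<le> f0 * (1 + norm p powr (\<alpha> - 1))"
      by (simp add: H0_def)
    then show ?thesis by eventually_elim (use pt True in blast)
  next
    case False
    with H0 have "AE p in lebesgue. f differentiable at p \<and> norm (grad f p) \<le> f0"
      by (simp add: H0_def)
    then show ?thesis by eventually_elim (use pt False in auto)
  qed
  have lip: "locally_lipschitz f" using H0 by (simp add: H0_def)
  show ?thesis by (rule lipschitz_from_ae_gradient_bound[OF lip ae xy(2,1)])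
qed

text \<open>
  The interior estimate on the ball of radius 2 around \<open>x\<close>, where both \<open>f\<close> and its Lipschitz
  constant are of order \<open>(|x| + 2) powr \<alpha>\<close>.
\<close>

lemma solution_gradient_growth:
  fixes u f :: "real^'m::finite \<Rightarrow> real"
  assumes u: "C_class 2 u"
    and eq: "\<And>y. - (1/2) * laplacian u y + (1/\<theta>) * norm (grad u y) powr \<theta> = f y - \<mu>"
    and \<theta>: "1 < \<theta>" and \<alpha>: "\<alpha> > 0" and f0: "f0 > 0" and H0: "H0 \<alpha> f0 f" and H1: "H1 \<alpha> f0 f"
  shows "\<exists>K>0. \<forall>y. norm (grad u y) \<le> K * (norm y + 2) powr (\<alpha>/\<theta>)"
proof -
  define C where "C = 1 + 3 * f0 + \<bar>\<mu>\<bar>"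
  have C: "C \<ge> 1" using f0 by (simp add: C_def)
  obtain K where K: "K > 0" and bound: "\<And>(u :: real^'m \<Rightarrow> real) F x0 A.
     C_class 2 u \<Longrightarrow> (\<forall>y. - (1/2) * laplacian u y + (1/\<theta>) * norm (grad u y) powr \<theta> = F y) \<Longrightarrow>
     A \<ge> 1 \<Longrightarrow> (\<forall>y\<in>ball x0 2. \<bar>F y\<bar> \<le> A powr \<theta>) \<Longrightarrow>
     (\<forall>x\<in>ball x0 2. \<forall>y\<in>ball x0 2. \<bar>F x - F y\<bar> \<le> A powr \<theta> * norm (x - y)) \<Longrightarrow>
     norm (grad u x0) \<le> K * A"
    using gradient_bound[OF \<theta>] by metis
  have "norm (grad u x) \<le> (K * C powr (1/\<theta>)) * (norm x + 2) powr (\<alpha>/\<theta>)" for x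
  proof -
    define s where "s = norm x + 2"
    define A where "A = C powr (1/\<theta>) * s powr (\<alpha>/\<theta>)"
    have s: "s \<ge> 1" by (simp add: s_def)
    have s\<alpha>: "s powr \<alpha> \<ge> 1" using s \<alpha> by (simp add: ge_one_powr_ge_zero)
    have A\<theta>: "A powr \<theta> = C * s powr \<alpha>"
      unfolding A_def using C s \<theta> by (subst powr_mult) (auto simp: powr_powr)
    have "1 * 1 \<le> A" unfolding A_def
      using C s \<alpha> \<theta> by (intro mult_mono ge_one_powr_ge_zero) auto
    then have A1: "A \<ge> 1" by simp
    have "norm (grad u x) \<le> K * A"
    proof (rule bound[OF u _ A1])
      show "\<forall>y. - (1/2) * laplacian u y + (1/\<theta>) * norm (grad u y) powr \<theta> = f y - \<mu>" using eq by blast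
      show "\<forall>y\<in>ball x 2. \<bar>f y - \<mu>\<bar> \<le> A powr \<theta>"
      proof
        fix y assume "y \<in> ball x 2"
        then have "norm y \<le> s"
          using norm_triangle_ineq2[of y x] by (simp add: s_def dist_norm norm_minus_commute)
        then have ys: "norm y powr \<alpha> \<le> s powr \<alpha>" using \<alpha> by (intro powr_mono2) auto
        have "inverse f0 * (norm y powr \<alpha> + 1) \<ge> 0" using f0 by simp
        then have "f y \<ge> 0" and "f y \<le> f0 * (norm y powr \<alpha> + 1)"
          using H1 unfolding H1_def by (metis order_trans, metis)
        then have "\<bar>f y - \<mu>\<bar> \<le> f0 * (norm y powr \<alpha> + 1) + \<bar>\<mu>\<bar>" by linarith
        also have "\<dots> \<le> f0 * (s powr \<alpha> + s powr \<alpha>) + \<bar>\<mu>\<bar> * s powr \<alpha>"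
          using f0 ys s\<alpha> mult_left_mono[OF s\<alpha>, of "\<bar>\<mu>\<bar>"] by (intro add_mono mult_left_mono) auto
        also have "\<dots> \<le> C * s powr \<alpha>"
          using f0 s\<alpha> mult_nonneg_nonneg[of f0 "s powr \<alpha>"] by (simp add: C_def algebra_simps)
        finally show "\<bar>f y - \<mu>\<bar> \<le> A powr \<theta>" by (simp add: A\<theta>)
      qed
      show "\<forall>y\<in>ball x 2. \<forall>z\<in>ball x 2. \<bar>(f y - \<mu>) - (f z - \<mu>)\<bar> \<le> A powr \<theta> * norm (y - z)"
      proof (intro ballI)
        fix y z assume yz: "y \<in> ball x 2" "z \<in> ball x 2"
        have "\<bar>(f y - \<mu>) - (f z - \<mu>)\<bar> \<le> f0 * (2 + s powr \<alpha>) * norm (y - z)"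
          using H0_lipschitz_on_ball[OF H0 \<alpha> f0 yz] by (simp add: s_def)
        also have "\<dots> \<le> A powr \<theta> * norm (y - z)"
        proof (rule mult_right_mono)
          have "f0 * 2 \<le> f0 * (2 * s powr \<alpha>)" using f0 s\<alpha> by (intro mult_left_mono) auto
          moreover have "C * s powr \<alpha> \<ge> 3 * f0 * s powr \<alpha>" by (intro mult_right_mono) (auto simp: C_def)
          ultimately show "f0 * (2 + s powr \<alpha>) \<le> A powr \<theta>" by (simp add: A\<theta> algebra_simps)
        qed simp
        finally show "\<bar>(f y - \<mu>) - (f z - \<mu>)\<bar> \<le> A powr \<theta> * norm (y - z)" .
      qed
    qed
    then show ?thesis by (simp add: A_def s_def)
  qed
  moreover have "K * C powr (1/\<theta>) > 0" using K C by simp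
  ultimately show ?thesis by blast
qed

lemma growth_from_gradient_growth:
  fixes u :: "real^'m::finite \<Rightarrow> real"
  assumes u: "\<And>x. u differentiable at x" and K: "K \<ge> 0" and s: "s \<ge> 0"
    and g: "\<And>y. norm (grad u y) \<le> K * (norm y + 2) powr s"
  shows "u y \<le> u 0 + K * (norm y + 2) powr (1 + s)"
proof -
  have d: "((\<lambda>t. u (t *\<^sub>R y)) has_real_derivative grad u (t *\<^sub>R y) \<bullet> y) (at t)" for t
  proof -
    have "((\<lambda>t. u (t *\<^sub>R y)) has_derivative (\<lambda>h. grad u (t *\<^sub>R y) \<bullet> (h *\<^sub>R y))) (at t)"
      by (rule has_derivative_compose[where f="\<lambda>t. t *\<^sub>R y"])
         (auto intro!: derivative_eq_intros has_derivative_grad u)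
    then show ?thesis by (simp add: has_field_derivative_def mult.commute[of _ "grad u (t *\<^sub>R y) \<bullet> y"])
  qed
  obtain t where t: "0 < t" "t < 1" "u (1 *\<^sub>R y) - u (0 *\<^sub>R y) = (1 - 0) * (grad u (t *\<^sub>R y) \<bullet> y)"
    using MVT2[of 0 1 "\<lambda>t. u (t *\<^sub>R y)" "\<lambda>t. grad u (t *\<^sub>R y) \<bullet> y"] d by auto
  have ty: "norm (t *\<^sub>R y) \<le> norm y" using t mult_right_mono[of t 1 "norm y"] by simp
  have "grad u (t *\<^sub>R y) \<bullet> y \<le> norm (grad u (t *\<^sub>R y)) * norm y" by (rule norm_cauchy_schwarz)
  also have "\<dots> \<le> (K * (norm (t *\<^sub>R y) + 2) powr s) * norm y" by (intro mult_right_mono g) auto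
  also have "\<dots> \<le> (K * (norm y + 2) powr s) * (norm y + 2)"
    using K s ty by (intro mult_mono mult_left_mono powr_mono2) auto
  also have "\<dots> = K * (norm y + 2) powr (1 + s)"
  proof -
    have "norm y + 2 = (norm y + 2) powr 1" using norm_ge_zero[of y] by (subst powr_one) auto
    then have "(norm y + 2) powr s * (norm y + 2) = (norm y + 2) powr (s + 1)"
      by (metis powr_add)
    then show ?thesis by (simp add: add.commute mult.assoc)
  qed
  finally show ?thesis using t(3) by simp
qed

lemma solution_growth:
  fixes u f :: "real^'m::finite \<Rightarrow> real"
  assumes u: "C_class 2 u"
    and eq: "\<And>y. - (1/2) * laplacian u y + (1/\<theta>) * norm (grad u y) powr \<theta> = f y - \<mu>"
    and \<theta>: "1 < \<theta>" and \<alpha>: "\<alpha> > 0" and f0: "f0 > 0" and H0: "H0 \<alpha> f0 f" and H1: "H1 \<alpha> f0 f"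
    and lb: "\<And>y. m0 \<le> u y"
  shows "\<exists>c K. c > 0 \<and> K > 0 \<and> eventually (\<lambda>\<rho>. \<forall>y. norm y = \<rho> \<longrightarrow>
       norm (grad u y) \<le> K * \<rho> powr (\<alpha>/\<theta>) \<and> c * \<rho> powr (1 + \<alpha>/\<theta>) \<le> u y \<and> u y \<le> K * \<rho> powr (1 + \<alpha>/\<theta>)) at_top"
proof -
  define s where "s = \<alpha> / \<theta>"
  have s: "s > 0" using \<alpha> \<theta> by (simp add: s_def)
  obtain K where K: "K > 0" and g: "\<And>y. norm (grad u y) \<le> K * (norm y + 2) powr s"
    using solution_gradient_growth[OF u eq \<theta> \<alpha> f0 H0 H1] unfolding s_def by blast
  have up: "u y \<le> u 0 + K * (norm y + 2) powr (1 + s)" for y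
    by (rule growth_from_gradient_growth[OF C2D(1)[OF u]]) (use K s g in auto)
  have "inverse f0 * norm y powr \<alpha> \<le> f y" for y
  proof -
    have "inverse f0 * norm y powr \<alpha> \<le> inverse f0 * (norm y powr \<alpha> + 1)"
      using f0 by (intro mult_left_mono) auto
    also have "\<dots> \<le> f y" using H1 by (simp add: H1_def)
    finally show ?thesis .
  qed
  then obtain c where c: "c > 0" and low: "eventually (\<lambda>\<rho>. \<forall>y. norm y = \<rho> \<longrightarrow> c * \<rho> powr (1 + s) \<le> u y) at_top"
    using bounded_below_solution_growth[OF u eq \<theta> \<alpha> _ _ lb, of "inverse f0"] f0 unfolding s_def by auto
  define K' where "K' = \<bar>u 0\<bar> + K * 2 powr (1 + s)"
  have K': "K' > 0" unfolding K'_def using K by (intro add_nonneg_pos) auto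
  have "eventually (\<lambda>\<rho>. \<forall>y. norm y = \<rho> \<longrightarrow>
       norm (grad u y) \<le> K' * \<rho> powr s \<and> c * \<rho> powr (1 + s) \<le> u y \<and> u y \<le> K' * \<rho> powr (1 + s)) at_top"
    using low eventually_ge_at_top[of "2::real"]
  proof eventually_elim
    case (elim \<rho>)
    have *: "(\<rho> + 2) powr t \<le> 2 powr t * \<rho> powr t" if "t \<ge> 0" for t
    proof -
      have "(\<rho> + 2) powr t \<le> (2 * \<rho>) powr t" using elim that by (intro powr_mono2) auto
      then show ?thesis using elim by (simp add: powr_mult)
    qed
    show ?case
    proof (intro allI impI conjI)
      fix y :: "real^'m" assume y: "norm y = \<rho>"
      show "c * \<rho> powr (1 + s) \<le> u y" using elim y by blast
      have "norm (grad u y) \<le> K * (2 powr s * \<rho> powr s)"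
        using g[of y] *[of s] s K y by (smt (verit) mult_left_mono)
      also have "\<dots> \<le> K * (2 powr (1 + s) * \<rho> powr s)"
        using K by (intro mult_left_mono mult_right_mono powr_mono) auto
      also have "\<dots> \<le> K' * \<rho> powr s"
        unfolding K'_def by (simp add: distrib_right mult.assoc)
      finally show "norm (grad u y) \<le> K' * \<rho> powr s" .
      have "\<rho> powr (1 + s) \<ge> 1" using elim s by (intro ge_one_powr_ge_zero) auto
      then have "u 0 \<le> \<bar>u 0\<bar> * \<rho> powr (1 + s)"
        using mult_left_mono[of 1 "\<rho> powr (1 + s)" "\<bar>u 0\<bar>"] by simp
      moreover have "K * (\<rho> + 2) powr (1 + s) \<le> K * (2 powr (1 + s) * \<rho> powr (1 + s))"
        using K s by (intro mult_left_mono *) auto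
      ultimately show "u y \<le> K' * \<rho> powr (1 + s)"
        using up[of y] y by (simp add: K'_def distrib_right mult.assoc)
    qed
  qed
  then show ?thesis using c K' unfolding s_def by blast
qed

section \<open>The strong maximum principle\<close>

text \<open>
  Hopf's argument. Otherwise a ball with centre \<open>c\<close> and radius \<open>R\<close> touches the set of maximum points
  at exactly one point \<open>z\<close>. With \<open>s = |x - c|\<^sup>2 - R\<^sup>2\<close> the barrier \<open>v = - s + N s\<^sup>2\<close> vanishes at \<open>z\<close>, is
  nonpositive outside the ball near \<open>z\<close>, and for large \<open>N\<close> satisfies \<open>L v > 0\<close> near \<open>z\<close>. Then
  \<open>w + \<epsilon> v\<close> has a local maximum near \<open>z\<close>, where \<open>L (w + \<epsilon> v) > 0\<close> is impossible.
\<close>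

lemma strong_maximum_principle:
  fixes w :: "real^'m::finite \<Rightarrow> real" and b :: "real^'m \<Rightarrow> real^'m"
  assumes w1: "\<And>i y. has_partial i w (w1 i y) y"
    and w2: "\<And>i y. has_partial i (w1 i) (w2 i y) y"
    and cw: "continuous_on UNIV w" and cb: "continuous_on UNIV b"
    and sub: "\<And>y. (1/2) * (\<Sum>i\<in>UNIV. w2 i y) - (\<Sum>i\<in>UNIV. b y $ i * w1 i y) \<ge> 0"
    and mx: "\<And>y. w y \<le> w x0"
  shows "w y = w x0"
proof (rule ccontr)
  assume ne: "w y \<noteq> w x0"
  define S where "S = {z. w z = w x0}"
  have clS: "closed S"
    unfolding S_def using continuous_closed_preimage_constant[OF cw closed_UNIV, of "w x0"] by simp
  obtain z where z: "z \<in> S" "\<And>z'. z' \<in> S \<Longrightarrow> dist y z \<le> dist y z'"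
    using distance_attains_inf[OF clS, of y] by (auto simp: S_def)
  have yz: "y \<noteq> z" using ne z(1) by (auto simp: S_def)
  define c where "c = (1/2) *\<^sub>R (y + z)"
  define R where "R = norm (z - c)"
  have zc: "z - c = (1/2) *\<^sub>R (z - y)" and "y - c = (1/2) *\<^sub>R (y - z)"
    by (simp_all add: c_def vec_eq_iff field_simps)
  then have yc: "dist y c = R" by (simp add: R_def dist_norm norm_minus_commute)
  have R: "R > 0" using yz by (simp add: R_def zc)
  have dyz: "dist y z = 2 * R" by (simp add: R_def zc dist_norm norm_minus_commute)
  \<comment> \<open>No maximum point is nearer to \<open>y\<close> than \<open>z\<close>, and the ball around the midpoint \<open>c\<close> is internally tangent at \<open>z\<close> to the larger ball around \<open>y\<close>.\<close>
  have touch: "w p < w x0" if "norm (p - c) \<le> R" "p \<noteq> z" for p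
  proof (rule ccontr)
    assume "\<not> w p < w x0"
    then have "p \<in> S" using mx[of p] by (simp add: S_def)
    then have "2 * R \<le> dist y p" using z(2) dyz by simp
    then have "norm ((y - c) + (c - p)) \<ge> 2 * R" by (simp add: dist_norm)
    moreover have "norm (y - c) = R" "norm (c - p) \<le> R" using yc that by (auto simp: dist_norm norm_minus_commute)
    ultimately have e: "norm ((y - c) + (c - p)) = norm (y - c) + norm (c - p)" "norm (c - p) = R"
      using norm_triangle_ineq[of "y - c" "c - p"] by auto
    then have "R *\<^sub>R (c - p) = R *\<^sub>R (y - c)"
      using e(1)[unfolded norm_triangle_eq] \<open>norm (y - c) = R\<close> by simp
    then have "c - p = y - c" using R by simp
    then have "p = z" by (simp add: c_def vec_eq_iff field_simps)
    with that show False by simp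
  qed
  define s where "s = (\<lambda>x. (norm (x - c))\<^sup>2 - R\<^sup>2)"
  have s1: "has_partial i s (2 * (x - c) $ i) x" for i x
    unfolding s_def using has_partial_diff[OF has_partial_norm_sq has_partial_const] by simp
  have s2: "has_partial i (\<lambda>x. 2 * (x - c) $ i) 2 x" for i x
    using has_partial_cmult[OF has_partial_component[of i c i x], of 2] by simp
  have cs: "continuous_on UNIV s" unfolding s_def by (intro continuous_intros)
  define m where "m = real CARD('m)"
  \<comment> \<open>This choice gives \<open>L v z \<ge> 1\<close>.\<close>
  define N where "N = (1 + m + 2 * norm (b z) * R) / (4 * R\<^sup>2)"
  have N: "N > 0" unfolding N_def m_def using R by (intro divide_pos_pos add_pos_nonneg) auto
  define v where "v = (\<lambda>x. - s x + N * (s x)\<^sup>2)"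
  define v1 where "v1 = (\<lambda>i x. (2 * N * s x - 1) * (2 * (x - c) $ i))"
  define v2 where "v2 = (\<lambda>i x. (2 * N * s x - 1) * 2 + 2 * N * (2 * (x - c) $ i)\<^sup>2)"
  have hv1: "has_partial i v (v1 i x) x" for i x
  proof -
    have "has_partial i (\<lambda>x. N * (s x)^2 - s x) (N * (real 2 * s x ^ (2-1) * (2 * (x - c) $ i)) - 2 * (x - c) $ i) x"
      by (intro has_partial_diff has_partial_cmult has_partial_power s1)
    then show ?thesis by (simp add: v_def v1_def algebra_simps)
  qed
  have hv2: "has_partial i (v1 i) (v2 i x) x" for i x
  proof -
    have "has_partial i (v1 i) ((2 * N * s x - 1) * 2 + (2 * N * (2 * (x - c) $ i) - 0) * (2 * (x - c) $ i)) x"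
      unfolding v1_def
      by (intro has_partial_mult has_partial_diff has_partial_cmult has_partial_const s1 s2)
    then show ?thesis by (simp add: v2_def power2_eq_square mult.assoc)
  qed
  define Lv where "Lv = (\<lambda>x. (1/2) * (\<Sum>i\<in>UNIV. v2 i x) - (\<Sum>i\<in>UNIV. b x $ i * v1 i x))"
  have Lv_eq: "Lv x = (2 * N * s x - 1) * m + 4 * N * (norm (x - c))\<^sup>2 - (2 * N * s x - 1) * 2 * (b x \<bullet> (x - c))" for x
  proof -
    have "v2 i x = (2 * N * s x - 1) * 2 + 8 * N * ((x - c) $ i)\<^sup>2" for i
      unfolding v2_def by (simp only: power_mult_distrib) simp
    then have "(\<Sum>i\<in>UNIV. v2 i x) = (2 * N * s x - 1) * 2 * m + 8 * N * (norm (x - c))\<^sup>2"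
      by (simp add: sum.distrib m_def norm_sq_sum sum_distrib_left[symmetric])
    moreover have "(\<Sum>i\<in>UNIV. b x $ i * v1 i x) = (2 * N * s x - 1) * 2 * (b x \<bullet> (x - c))"
      unfolding v1_def inner_vec_def sum_distrib_left
      by (intro sum.cong refl) (simp add: algebra_simps)
    ultimately show ?thesis by (simp add: Lv_def)
  qed
  have cLv: "continuous_on UNIV Lv"
    unfolding Lv_eq by (intro continuous_intros cs cb)
  have sz: "s z = 0" by (simp add: s_def R_def)
  have "Lv z > 0"
  proof -
    have "b z \<bullet> (z - c) \<ge> - (norm (b z) * R)"
      using Cauchy_Schwarz_ineq2[of "b z" "z - c"] by (simp add: R_def)
    moreover have "4 * N * (norm (z - c))\<^sup>2 = 1 + m + 2 * norm (b z) * R"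
      using R by (simp add: N_def R_def)
    ultimately show ?thesis unfolding Lv_eq sz by simp
  qed
  have "isCont Lv z" using cLv by (simp add: continuous_on_eq_continuous_at)
  then obtain r1 where r1: "r1 > 0" "\<And>x. dist x z < r1 \<Longrightarrow> Lv x > 0"
    using \<open>Lv z > 0\<close> unfolding continuous_at_eps_delta
    by (metis dist_real_def abs_diff_less_iff diff_gt_0_iff_gt cancel_comm_monoid_add_class.diff_cancel)
  have "isCont s z" using cs by (simp add: continuous_on_eq_continuous_at)
  then obtain r2 where r2: "r2 > 0" "\<And>x. dist x z < r2 \<Longrightarrow> \<bar>s x\<bar> < 1 / N"
    unfolding continuous_at_eps_delta dist_real_def sz using N by (metis diff_zero divide_pos_pos zero_less_one)
  define r where "r = min r1 r2 / 2"
  have r: "r > 0" "r < r1" "r < r2" using r1 r2 by (auto simp: r_def)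
  define A where "A = sphere z r \<inter> cball c R"
  have cA: "compact A" unfolding A_def by (intro compact_Int_closed) auto
  have cv: "continuous_on UNIV v" unfolding v_def by (intro continuous_intros cs)
  have vneg: "v x \<le> 0" if "dist x z \<le> r" "x \<notin> cball c R" for x
  proof -
    have "s x > 0"
    proof -
      have "R < norm (x - c)" using that by (simp add: dist_norm norm_minus_commute)
      then have "R\<^sup>2 < (norm (x - c))\<^sup>2" using R by (intro power_strict_mono) auto
      then show ?thesis by (simp add: s_def)
    qed
    moreover have "s x < 1 / N" using r2(2)[of x] that r by auto
    then have "N * s x \<le> 1" using N by (simp add: field_simps)
    ultimately have "s x * (N * s x - 1) \<le> 0" by (simp add: mult_nonneg_nonpos)
    then show ?thesis by (simp add: v_def power2_eq_square algebra_simps)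
  qed
  obtain \<epsilon> where eps: "\<epsilon> > 0" "\<And>x. x \<in> A \<Longrightarrow> w x + \<epsilon> * v x \<le> w x0"
  proof (cases "A = {}")
    case True then show ?thesis using that[of 1] by simp
  next
    case False
    obtain a where a: "a \<in> A" "\<And>x. x \<in> A \<Longrightarrow> w x \<le> w a"
      using continuous_attains_sup[OF cA False continuous_on_subset[OF cw]] by auto
    obtain a' where a': "a' \<in> A" "\<And>x. x \<in> A \<Longrightarrow> v x \<le> v a'"
      using continuous_attains_sup[OF cA False continuous_on_subset[OF cv]] by auto
    have wa: "w a < w x0" using a r by (intro touch) (auto simp: A_def dist_norm norm_minus_commute)
    define \<epsilon> where "\<epsilon> = (w x0 - w a) / (1 + \<bar>v a'\<bar>)"
    have e: "\<epsilon> > 0" using wa by (simp add: \<epsilon>_def)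
    have "w x + \<epsilon> * v x \<le> w x0" if "x \<in> A" for x
    proof -
      have "\<epsilon> * v x \<le> \<epsilon> * (1 + \<bar>v a'\<bar>)" using e a'(2)[OF that] by (intro mult_left_mono) auto
      also have "\<dots> = w x0 - w a" by (simp add: \<epsilon>_def)
      finally show ?thesis using a(2)[OF that] by simp
    qed
    then show ?thesis using that e by blast
  qed
  define G where "G = (\<lambda>x. w x + \<epsilon> * v x)"
  have cG: "continuous_on UNIV G" unfolding G_def by (intro continuous_intros cw cv)
  have Gz: "G z = w x0" using z(1) by (simp add: G_def v_def sz S_def)
  have Gbd: "G x \<le> w x0" if "x \<in> sphere z r" for x
  proof (cases "x \<in> A")
    case True then show ?thesis using eps(2) by (simp add: G_def)
  next
    case False
    then have "v x \<le> 0" using that by (intro vneg) (auto simp: A_def dist_commute)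
    then have "\<epsilon> * v x \<le> 0" using eps(1) by (simp add: mult_nonneg_nonpos)
    then show ?thesis using mx[of x] by (simp add: G_def)
  qed
  obtain q0 where q0: "q0 \<in> cball z r" "\<And>x. x \<in> cball z r \<Longrightarrow> G x \<le> G q0"
    using continuous_attains_sup[OF compact_cball _ continuous_on_subset[OF cG], of z r] r by auto
  obtain q where q: "q \<in> ball z r" "\<And>x. x \<in> ball z r \<Longrightarrow> G x \<le> G q"
  proof (cases "q0 \<in> ball z r")
    case True then show ?thesis using that q0 by auto
  next
    case False
    then have "G q0 \<le> G z" using Gbd[of q0] q0(1) Gz by auto
    then have "G x \<le> G z" if "x \<in> ball z r" for x
      using q0(2)[of x] that by auto
    then show ?thesis using that[of z] r by auto
  qed
  obtain \<rho> where rho: "\<rho> > 0" "ball q \<rho> \<subseteq> ball z r"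
    using q(1) open_ball open_contains_ball by blast
  have G1: "has_partial i G (w1 i x + \<epsilon> * v1 i x) x" for i x
    unfolding G_def by (intro has_partial_add has_partial_cmult w1 hv1)
  have G2: "has_partial i (\<lambda>x. w1 i x + \<epsilon> * v1 i x) (w2 i x + \<epsilon> * v2 i x) x" for i x
    by (intro has_partial_add has_partial_cmult w2 hv2)
  have Gm: "G x \<le> G q" if "x \<in> ball q \<rho>" for x using that rho q by blast
  note crit = local_max_grad_laplacian[OF rho(1) G1 G2 Gm]
  have "(1/2) * (\<Sum>i\<in>UNIV. w2 i q) - (\<Sum>i\<in>UNIV. b q $ i * w1 i q) + \<epsilon> * Lv q
      = (1/2) * (\<Sum>i\<in>UNIV. w2 i q + \<epsilon> * v2 i q) - (\<Sum>i\<in>UNIV. b q $ i * (w1 i q + \<epsilon> * v1 i q))"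
    by (simp add: Lv_def sum.distrib sum_distrib_left algebra_simps)
  also have "\<dots> \<le> 0" using crit by simp
  finally have "\<epsilon> * Lv q \<le> 0" using sub[of q] by simp
  moreover have "Lv q > 0" using r1(2)[of q] q(1) r by (simp add: dist_commute)
  ultimately show False using eps(1) by (simp add: mult_le_0_iff)
qed

section \<open>Comparison of two solutions\<close>

text \<open>
  The maximum of \<open>w - \<epsilon> V\<close> exists because \<open>V\<close> dominates \<open>w\<close>, and it lies in the region where
  \<open>L V < 0\<close> fails, since \<open>L (w - \<epsilon> V) > 0\<close> elsewhere. That region is bounded and independent of \<open>\<epsilon>\<close>, so
  the limit \<open>\<epsilon> \<rightarrow> 0\<close> bounds \<open>w\<close> by its maximum over a fixed ball.
\<close>

lemma bounded_by_lyapunov_max: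
  fixes w V :: "real^'m::finite \<Rightarrow> real" and b :: "real^'m \<Rightarrow> real^'m"
  assumes w1: "\<And>i y. has_partial i w (w1 i y) y"
    and w2: "\<And>i y. has_partial i (w1 i) (w2 i y) y"
    and V1: "\<And>i y. has_partial i V (V1 i y) y"
    and V2: "\<And>i y. has_partial i (V1 i) (V2 i y) y"
    and cw: "continuous_on UNIV w" and cV: "continuous_on UNIV V" and V0: "\<And>y. V y \<ge> 0"
    and sub: "\<And>y. (1/2) * (\<Sum>i\<in>UNIV. w2 i y) - (\<Sum>i\<in>UNIV. b y $ i * w1 i y) \<ge> 0"
    and lyap: "eventually (\<lambda>\<rho>. \<forall>y. norm y = \<rho> \<longrightarrow>
        (1/2) * (\<Sum>i\<in>UNIV. V2 i y) - (\<Sum>i\<in>UNIV. b y $ i * V1 i y) < 0) at_top"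
    and dom: "\<And>\<epsilon> B. \<epsilon> > 0 \<Longrightarrow> eventually (\<lambda>\<rho>. \<forall>y. norm y = \<rho> \<longrightarrow> w y - \<epsilon> * V y \<le> B) at_top"
  obtains x where "\<And>y. w y \<le> w x"
proof -
  obtain R0 where R0: "\<And>y. norm y \<ge> R0 \<Longrightarrow> (1/2) * (\<Sum>i\<in>UNIV. V2 i y) - (\<Sum>i\<in>UNIV. b y $ i * V1 i y) < 0"
    using lyap unfolding eventually_at_top_linorder by blast
  define R where "R = max R0 0"
  obtain x where x: "\<And>y. y \<in> cball 0 R \<Longrightarrow> w y \<le> w x"
    using continuous_attains_sup[OF compact_cball _ continuous_on_subset[OF cw], of 0 R]
    by (force simp: R_def)
  have eps: "w y \<le> w x + \<epsilon> * V y" if e: "\<epsilon> > 0" for y \<epsilon>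
  proof -
    define G where "G = (\<lambda>y. w y - \<epsilon> * V y)"
    obtain N where N: "\<And>y. norm y \<ge> N \<Longrightarrow> G y \<le> G 0"
      using dom[OF e, of "G 0"] unfolding eventually_at_top_linorder G_def by blast
    have cG: "continuous_on UNIV G" unfolding G_def by (intro continuous_intros cw cV)
    obtain q where q: "\<And>y. y \<in> cball 0 (max N 0) \<Longrightarrow> G y \<le> G q"
      using continuous_attains_sup[OF compact_cball _ continuous_on_subset[OF cG], of 0 "max N 0"] by force
    have mx: "G y \<le> G q" for y
    proof (cases "norm y \<le> max N 0")
      case False
      then have "G y \<le> G 0" by (intro N) auto
      also have "\<dots> \<le> G q" by (rule q) simp
      finally show ?thesis .
    qed (use q in simp)
    have G1: "has_partial i G (w1 i y - \<epsilon> * V1 i y) y" for i y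
      unfolding G_def by (intro has_partial_diff has_partial_cmult w1 V1)
    have G2: "has_partial i (\<lambda>y. w1 i y - \<epsilon> * V1 i y) (w2 i q - \<epsilon> * V2 i q) q" for i
      by (intro has_partial_diff has_partial_cmult w2 V2)
    note crit = local_max_grad_laplacian[OF zero_less_one G1 G2 mx]
    have "((1/2) * (\<Sum>i\<in>UNIV. w2 i q) - (\<Sum>i\<in>UNIV. b q $ i * w1 i q))
        - \<epsilon> * ((1/2) * (\<Sum>i\<in>UNIV. V2 i q) - (\<Sum>i\<in>UNIV. b q $ i * V1 i q))
      = (1/2) * (\<Sum>i\<in>UNIV. w2 i q - \<epsilon> * V2 i q) - (\<Sum>i\<in>UNIV. b q $ i * (w1 i q - \<epsilon> * V1 i q))"
      by (simp add: sum_subtractf sum_distrib_left algebra_simps)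
    also have "\<dots> \<le> 0" using crit by simp
    finally have "\<epsilon> * ((1/2) * (\<Sum>i\<in>UNIV. V2 i q) - (\<Sum>i\<in>UNIV. b q $ i * V1 i q)) \<ge> 0"
      using sub[of q] by linarith
    then have "norm q < R0" using R0[of q] e by (smt (verit) mult_pos_neg)
    then have "w q \<le> w x" by (intro x) (simp add: R_def)
    moreover have "0 \<le> \<epsilon> * V q" using e V0[of q] by simp
    ultimately have "G q \<le> w x" by (simp add: G_def)
    with mx[of y] show ?thesis by (simp add: G_def)
  qed
  have "w y \<le> w x" for y
  proof (rule field_le_epsilon)
    fix e :: real assume e: "e > 0"
    have "w y \<le> w x + e / (V y + 1) * V y" using e V0[of y] by (intro eps) auto
    also have "e / (V y + 1) * V y \<le> e" using e V0[of y] by (simp add: field_simps)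
    finally show "w y \<le> w x + e" by simp
  qed
  with that show thesis .
qed

text \<open>
  Subtracting the equations leaves \<open>H (D\<phi>) - H (D\<psi>)\<close>, which convexity bounds below by its
  linearisation at \<open>D\<psi>\<close>.
\<close>

lemma difference_subsolution:
  assumes \<theta>: "1 < \<theta>"
    and eq\<phi>: "\<And>y. - (1/2) * laplacian \<phi> y + (1/\<theta>) * norm (grad \<phi> y) powr \<theta> = f y - lam1"
    and eq\<psi>: "\<And>y. - (1/2) * laplacian \<psi> y + (1/\<theta>) * norm (grad \<psi> y) powr \<theta> = f y - lam2"
  shows "(1/2) * (\<Sum>i\<in>UNIV. partial_deriv i (partial_deriv i \<phi>) y - partial_deriv i (partial_deriv i \<psi>) y)
     - (\<Sum>i\<in>UNIV. (norm (grad \<psi> y) powr (\<theta> - 2) *\<^sub>R grad \<psi> y) $ i * (grad \<phi> y $ i - grad \<psi> y $ i)) \<ge> lam1 - lam2"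
proof -
  have "(\<Sum>i\<in>UNIV. (norm (grad \<psi> y) powr (\<theta> - 2) *\<^sub>R grad \<psi> y) $ i * (grad \<phi> y $ i - grad \<psi> y $ i))
     = (norm (grad \<psi> y) powr (\<theta> - 2) *\<^sub>R grad \<psi> y) \<bullet> (grad \<phi> y - grad \<psi> y)"
    by (simp add: inner_vec_def)
  also have "\<dots> \<le> (1/\<theta>) * norm (grad \<phi> y) powr \<theta> - (1/\<theta>) * norm (grad \<psi> y) powr \<theta>"
    by (rule norm_powr_convex[OF \<theta>])
  also have "\<dots> = (1/2) * laplacian \<phi> y - (1/2) * laplacian \<psi> y - (lam1 - lam2)"
    using eq\<phi>[of y] eq\<psi>[of y] by linarith
  finally show ?thesis unfolding laplacian_def sum_subtractf by (simp add: diff_divide_distrib)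
qed

text \<open>
  The left-hand side is \<open>L\<close> applied to the square of \<open>\<psi> + const\<close>, with \<open>s\<close> the value of
  \<open>\<psi> + const\<close> at \<open>y\<close>. Convexity of \<open>H\<close> between 0 and \<open>D\<psi>\<close> shows that the drift term
  outweighs the term \<open>H (D\<psi>)\<close> coming from the Laplacian.
\<close>

lemma solution_lyapunov:
  fixes \<psi> :: "real^'m::finite \<Rightarrow> real"
  assumes \<theta>: "1 < \<theta>"
    and eq: "- (1/2) * laplacian \<psi> y + (1/\<theta>) * norm (grad \<psi> y) powr \<theta> = F"
    and s: "s \<ge> 0"
  shows "(1/2) * (\<Sum>i\<in>UNIV. 2 * (s * partial_deriv i (partial_deriv i \<psi>) y + grad \<psi> y $ i * grad \<psi> y $ i))
      - (\<Sum>i\<in>UNIV. (norm (grad \<psi> y) powr (\<theta> - 2) *\<^sub>R grad \<psi> y) $ i * (2 * (s * grad \<psi> y $ i)))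
     \<le> (norm (grad \<psi> y))\<^sup>2 - 2 * s * F"
proof -
  define p where "p = grad \<psi> y"
  have "(norm p powr (\<theta> - 2) *\<^sub>R p) \<bullet> (0 - p) \<le> (1/\<theta>) * norm (0::real^'m) powr \<theta> - (1/\<theta>) * norm p powr \<theta>"
    by (rule norm_powr_convex[OF \<theta>])
  then have b: "(1/\<theta>) * norm p powr \<theta> \<le> (norm p powr (\<theta> - 2) *\<^sub>R p) \<bullet> p" using \<theta> by simp
  have "(1/2) * (\<Sum>i\<in>UNIV. 2 * (s * partial_deriv i (partial_deriv i \<psi>) y + p $ i * p $ i))
      = s * laplacian \<psi> y + (norm p)\<^sup>2"
    by (simp add: norm_sq_sum laplacian_def sum.distrib sum_distrib_left[symmetric] power2_eq_square[symmetric])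
  moreover have "(\<Sum>i\<in>UNIV. (norm p powr (\<theta> - 2) *\<^sub>R p) $ i * (2 * (s * p $ i)))
      = 2 * s * ((norm p powr (\<theta> - 2) *\<^sub>R p) \<bullet> p)"
    by (simp add: inner_vec_def sum_distrib_left mult_ac)
  moreover have "s * laplacian \<psi> y = 2 * s * ((1/\<theta>) * norm p powr \<theta>) - 2 * s * F"
  proof -
    have "s * l = 2 * s * h - 2 * s * F" if "- (1/2) * l + h = F" for l h :: real
      using that by (auto simp: algebra_simps)
    then show ?thesis using eq unfolding p_def by blast
  qed
  moreover have "2 * s * ((1/\<theta>) * norm p powr \<theta>) \<le> 2 * s * ((norm p powr (\<theta> - 2) *\<^sub>R p) \<bullet> p)"
    using s by (intro mult_left_mono b) auto
  ultimately show ?thesis unfolding p_def[symmetric] by linarith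
qed

text \<open>
  The shift in \<open>S\<close> makes it at least 1 and, as \<open>m1 \<le> 0\<close>, also at least \<open>\<psi>\<close>, so that it inherits the
  lower growth of \<open>\<psi>\<close>.
\<close>

lemma ergodic_uniqueness_ordered:
  fixes f \<phi> \<psi> :: "real^'m::finite \<Rightarrow> real"
  assumes \<theta>: "1 < \<theta>" and \<alpha>: "\<alpha> > 0" and f0: "f0 > 0" and H0: "H0 \<alpha> f0 f" and H1: "H1 \<alpha> f0 f"
    and u\<phi>: "C_class 2 \<phi>"
    and eq\<phi>: "\<And>y. - (1/2) * laplacian \<phi> y + (1/\<theta>) * norm (grad \<phi> y) powr \<theta> = f y - lam1"
    and u\<psi>: "C_class 2 \<psi>"
    and eq\<psi>: "\<And>y. - (1/2) * laplacian \<psi> y + (1/\<theta>) * norm (grad \<psi> y) powr \<theta> = f y - lam2"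
    and lb: "\<And>y. m0 \<le> \<phi> y" "\<And>y. m0 \<le> \<psi> y"
    and le: "lam2 \<le> lam1"
  shows "lam1 = lam2 \<and> (\<exists>C. \<forall>y. \<phi> y = \<psi> y + C)"
proof -
  define m1 where "m1 = min m0 0"
  have m1: "m1 \<le> 0" "\<And>y. m1 \<le> \<psi> y"
    using lb(2) by (auto simp: m1_def intro: min.coboundedI1)
  define \<gamma> where "\<gamma> = 1 + \<alpha> / \<theta>"
  have \<gamma>: "\<gamma> > 1" using \<alpha> \<theta> by (simp add: \<gamma>_def)
  define b where "b = (\<lambda>y. norm (grad \<psi> y) powr (\<theta> - 2) *\<^sub>R grad \<psi> y)"
  define w where "w = (\<lambda>y. \<phi> y - \<psi> y)"
  define w1 where "w1 = (\<lambda>i y. grad \<phi> y $ i - grad \<psi> y $ i)"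
  define w2 where "w2 = (\<lambda>i y. partial_deriv i (partial_deriv i \<phi>) y - partial_deriv i (partial_deriv i \<psi>) y)"
  have hw1: "has_partial i w (w1 i y) y" for i y
    unfolding w_def w1_def by (intro has_partial_diff C2_has_partial u\<phi> u\<psi>)
  have hw2: "has_partial i (w1 i) (w2 i y) y" for i y
    unfolding w1_def w2_def by (intro has_partial_diff C2_has_partial u\<phi> u\<psi>)
  have cw: "continuous_on UNIV w"
    unfolding w_def by (intro continuous_intros C2_continuous(1) u\<phi> u\<psi>)
  have cb: "continuous_on UNIV b" unfolding b_def by (rule gradient_drift_continuous[OF u\<psi> \<theta>])
  have sub': "(1/2) * (\<Sum>i\<in>UNIV. w2 i y) - (\<Sum>i\<in>UNIV. b y $ i * w1 i y) \<ge> lam1 - lam2" for y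
    unfolding w1_def w2_def b_def by (rule difference_subsolution[OF \<theta> eq\<phi> eq\<psi>])
  have sub: "(1/2) * (\<Sum>i\<in>UNIV. w2 i y) - (\<Sum>i\<in>UNIV. b y $ i * w1 i y) \<ge> 0" for y
    using sub'[of y] le by linarith
  define S where "S = (\<lambda>y. \<psi> y - (m1 - 1))"
  have S1: "S y \<ge> 1" for y using m1(2)[of y] by (simp add: S_def)
  define V where "V = (\<lambda>y. S y * S y)"
  define V1 where "V1 = (\<lambda>i y. 2 * (S y * grad \<psi> y $ i))"
  define V2 where "V2 = (\<lambda>i y. 2 * (S y * partial_deriv i (partial_deriv i \<psi>) y + grad \<psi> y $ i * grad \<psi> y $ i))"
  have hS: "has_partial i S (grad \<psi> y $ i) y" for i y
    unfolding S_def using has_partial_diff[OF C2_has_partial(1)[OF u\<psi>] has_partial_const] by simp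
  have hV1: "has_partial i V (V1 i y) y" for i y
    unfolding V_def V1_def using has_partial_mult[OF hS hS, of i y] by (simp add: mult.commute)
  have hV2: "has_partial i (V1 i) (V2 i y) y" for i y
    unfolding V1_def V2_def by (intro has_partial_cmult has_partial_mult hS C2_has_partial u\<psi>)
  have cV: "continuous_on UNIV V"
    unfolding V_def S_def by (intro continuous_intros C2_continuous(1) u\<psi>)
  have V0: "V y \<ge> 0" for y by (simp add: V_def)
  obtain c K where c: "c > 0" and K: "K > 0" and gr\<psi>: "eventually (\<lambda>\<rho>. \<forall>y. norm y = \<rho> \<longrightarrow>
       norm (grad \<psi> y) \<le> K * \<rho> powr (\<alpha>/\<theta>) \<and> c * \<rho> powr \<gamma> \<le> \<psi> y \<and> \<psi> y \<le> K * \<rho> powr \<gamma>) at_top"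
    using solution_growth[OF u\<psi> eq\<psi> \<theta> \<alpha> f0 H0 H1 lb(2)] unfolding \<gamma>_def by auto
  obtain K' where K': "K' > 0" and gr\<phi>: "eventually (\<lambda>\<rho>. \<forall>y. norm y = \<rho> \<longrightarrow> \<phi> y \<le> K' * \<rho> powr \<gamma>) at_top"
  proof -
    obtain c' K' where "K' > 0" and "eventually (\<lambda>\<rho>. \<forall>y. norm y = \<rho> \<longrightarrow>
       norm (grad \<phi> y) \<le> K' * \<rho> powr (\<alpha>/\<theta>) \<and> c' * \<rho> powr \<gamma> \<le> \<phi> y \<and> \<phi> y \<le> K' * \<rho> powr \<gamma>) at_top"
      using solution_growth[OF u\<phi> eq\<phi> \<theta> \<alpha> f0 H0 H1 lb(1)] unfolding \<gamma>_def by auto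
    then show ?thesis by (intro that[of K']) (auto elim: eventually_mono)
  qed
  have lyap: "eventually (\<lambda>\<rho>. \<forall>y. norm y = \<rho> \<longrightarrow>
        (1/2) * (\<Sum>i\<in>UNIV. V2 i y) - (\<Sum>i\<in>UNIV. b y $ i * V1 i y) < 0) at_top"
  proof -
    \<comment> \<open>The exponent by which \<open>\<psi> f\<close> outgrows \<open>|D\<psi>|\<^sup>2\<close>; it is positive because \<open>\<theta> > 1\<close>.\<close>
    define d where "d = 1 + \<alpha> - \<alpha> / \<theta>"
    have "\<alpha> / \<theta> \<le> \<alpha>" using \<alpha> \<theta> by (simp add: field_simps)
    then have d: "d > 0" by (simp add: d_def)
    have "eventually (\<lambda>\<rho>. \<rho> powr \<alpha> > 2 * lam2 * f0) at_top"
      by (rule powr_eventually_greater[OF \<alpha>])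
    moreover have "eventually (\<lambda>\<rho>. \<rho> powr d > K\<^sup>2 * f0 / c) at_top"
      by (rule powr_eventually_greater[OF d])
    ultimately show ?thesis using gr\<psi> eventually_gt_at_top[of "0::real"]
    proof eventually_elim
      case (elim \<rho>)
      show ?case
      proof (intro allI impI)
        fix y :: "real^'m" assume y: "norm y = \<rho>"
        define X where "X = \<rho> powr (\<alpha> / \<theta>)"
        have g: "(norm (grad \<psi> y))\<^sup>2 \<le> K\<^sup>2 * X\<^sup>2"
          using elim y power_mono[of "norm (grad \<psi> y)" "K * X" 2] by (simp add: X_def power_mult_distrib)
        have "inverse f0 * (\<rho> powr \<alpha> + 1) \<le> f y" using H1 y by (auto simp: H1_def)
        moreover have "inverse f0 * \<rho> powr \<alpha> \<le> inverse f0 * (\<rho> powr \<alpha> + 1)"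
          using f0 by (intro mult_left_mono) auto
        moreover have "lam2 < inverse f0 * \<rho> powr \<alpha> / 2" using elim(1) f0 by (simp add: field_simps)
        ultimately have F: "f y - lam2 \<ge> inverse f0 * \<rho> powr \<alpha> / 2" by linarith
        have Sl: "S y \<ge> c * \<rho> powr \<gamma>"
        proof -
          have "c * \<rho> powr \<gamma> \<le> \<psi> y" using elim y by blast
          then show ?thesis using m1(1) by (simp add: S_def)
        qed
        have "(c * \<rho> powr \<gamma>) * (inverse f0 * \<rho> powr \<alpha> / 2) \<le> S y * (f y - lam2)"
          using Sl F f0 c S1[of y] by (intro mult_mono) auto
        moreover have "\<rho> powr \<gamma> * \<rho> powr \<alpha> = \<rho> powr d * X\<^sup>2"
        proof -
          have "\<rho> powr \<gamma> * \<rho> powr \<alpha> = \<rho> powr (d + (\<alpha>/\<theta> + \<alpha>/\<theta>))"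
            by (subst powr_add[symmetric]) (simp add: \<gamma>_def d_def add_ac)
          then show ?thesis by (simp only: X_def powr_add power2_eq_square)
        qed
        ultimately have "(c * \<rho> powr d / f0) * X\<^sup>2 \<le> 2 * S y * (f y - lam2)"
          using f0 by (simp add: field_simps)
        moreover have "K\<^sup>2 * X\<^sup>2 < (c * \<rho> powr d / f0) * X\<^sup>2"
        proof (rule mult_strict_right_mono)
          show "K\<^sup>2 < c * \<rho> powr d / f0" using elim(2) f0 c by (simp add: field_simps)
          show "0 < X\<^sup>2" using elim by (simp add: X_def)
        qed
        ultimately have "(norm (grad \<psi> y))\<^sup>2 - 2 * S y * (f y - lam2) < 0" using g by linarith
        with solution_lyapunov[OF \<theta> eq\<psi>[of y], of "S y"] S1[of y]
        show "(1/2) * (\<Sum>i\<in>UNIV. V2 i y) - (\<Sum>i\<in>UNIV. b y $ i * V1 i y) < 0"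
          unfolding V1_def V2_def b_def by linarith
      qed
    qed
  qed
  have dom: "eventually (\<lambda>\<rho>. \<forall>y. norm y = \<rho> \<longrightarrow> w y - \<epsilon> * V y \<le> B) at_top" if e: "\<epsilon> > 0" for \<epsilon> B
  proof -
    \<comment> \<open>Once \<open>X = \<rho> powr \<gamma>\<close> exceeds 1 and \<open>T / (\<epsilon> c\<^sup>2)\<close>, the quadratic lower bound of \<open>\<epsilon> V\<close> in \<open>X\<close> beats the linear bound of \<open>w\<close>.\<close>
    define T where "T = K' + \<bar>m1\<bar> + \<bar>B\<bar>"
    have "eventually (\<lambda>\<rho>. \<rho> powr \<gamma> > max 1 (T / (\<epsilon> * c\<^sup>2))) at_top"
      using \<gamma> by (intro powr_eventually_greater) auto
    then show ?thesis using gr\<psi> gr\<phi>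
    proof eventually_elim
      case (elim \<rho>)
      define X where "X = \<rho> powr \<gamma>"
      have X: "X > 1" "\<epsilon> * c\<^sup>2 * X > T" using elim(1) e c by (auto simp: X_def field_simps)
      show ?case
      proof (intro allI impI)
        fix y :: "real^'m" assume y: "norm y = \<rho>"
        have "\<phi> y \<le> K' * X" "c * X \<le> \<psi> y" using elim y by (auto simp: X_def)
        then have S: "c * X \<le> S y" and wy: "w y \<le> K' * X + \<bar>m1\<bar>"
          using m1(1) m1(2)[of y] by (auto simp: S_def w_def)
        have "(c * X) * (c * X) \<le> V y"
          unfolding V_def using S c X S1[of y] by (intro mult_mono) auto
        then have "\<epsilon> * ((c * X) * (c * X)) \<le> \<epsilon> * V y" using e by (intro mult_left_mono) auto
        moreover have "T * X \<le> (\<epsilon> * c\<^sup>2 * X) * X" using X by (intro mult_right_mono) auto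
        moreover have "(\<bar>m1\<bar> + \<bar>B\<bar>) * 1 \<le> (\<bar>m1\<bar> + \<bar>B\<bar>) * X" using X by (intro mult_left_mono) auto
        ultimately show "w y - \<epsilon> * V y \<le> B"
          using wy by (simp add: T_def algebra_simps power2_eq_square)
      qed
    qed
  qed
  obtain x where x: "\<And>y. w y \<le> w x"
    using bounded_by_lyapunov_max[OF hw1 hw2 hV1 hV2 cw cV V0 sub lyap dom] by blast
  have const: "w y = w x" for y
    by (rule strong_maximum_principle[OF hw1 hw2 cw cb sub x])
  note crit = local_max_grad_laplacian[OF zero_less_one hw1 hw2 x]
  have "lam1 - lam2 \<le> 0" using sub'[of x] crit by simp
  then have "lam1 = lam2" using le by simp
  moreover have "\<phi> y = \<psi> y + w x" for y using const[of y] by (simp add: w_def)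
  ultimately show ?thesis by blast
qed

theorem theorem3p10:
  fixes f \<phi> \<psi> :: "real^'m \<Rightarrow> real"
    and \<theta> \<alpha> f0 lam1 lam2 :: real
  assumes "1 < \<theta>" and "\<theta> < 2"
    and "\<alpha> > 0" and "f0 > 0"
    and "H0 \<alpha> f0 f" and "H1 \<alpha> f0 f"
    and "EP_solution \<theta> f (lam1, \<phi>)" and "EP_solution \<theta> f (lam2, \<psi>)"
    and "bdd_below (range \<phi>)" and "bdd_below (range \<psi>)"
  shows "lam1 = lam2 \<and> (\<exists>C. \<forall>y. \<phi> y = \<psi> y + C)"
proof -
  have \<phi>: "C_class 2 \<phi>" "\<And>y. - (1/2) * laplacian \<phi> y + (1/\<theta>) * norm (grad \<phi> y) powr \<theta> = f y - lam1"
    and \<psi>: "C_class 2 \<psi>" "\<And>y. - (1/2) * laplacian \<psi> y + (1/\<theta>) * norm (grad \<psi> y) powr \<theta> = f y - lam2"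
    using assms(7,8) by (simp_all only: EP_solution_def prod.case)
  obtain a b where "\<And>y. a \<le> \<phi> y" "\<And>y. b \<le> \<psi> y"
    using assms(9,10) unfolding bdd_below_def by auto
  then have lb: "min a b \<le> \<phi> y" "min a b \<le> \<psi> y" for y by (meson min.coboundedI1 min.coboundedI2)+
  note main = ergodic_uniqueness_ordered[OF assms(1,3,4,5,6)]
  show ?thesis
  proof (cases "lam2 \<le> lam1")
    case True
    from main[OF \<phi> \<psi> lb this] show ?thesis .
  next
    case False
    then have "lam2 = lam1 \<and> (\<exists>C. \<forall>y. \<psi> y = \<phi> y + C)"
      by (intro main[OF \<psi> \<phi> lb(2,1)]) simp
    then obtain C where "lam1 = lam2" "\<And>y. \<psi> y = \<phi> y + C" by blast
    then show ?thesis by (intro conjI exI[of _ "- C"]) auto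
  qed
qed

end
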